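(* Let $r \ge 2$ and let $X \subset \mathbb{P}^r$ be a smooth connected complete intersection defined over $\mathbb{F}_q$. Let $m \ge 0$ be an integer and let $G$ be a divisor on $X$ such that $L(G) \supseteq H^0(\mathbb{P}^r, \mathcal{O}_{\mathbb{P}^r}(m))$, i.e. $L(G)$ contains the restrictions to $X$ of all polynomials of degree at most $m$ in the affine coordinates $x_1,\dots,x_r$ of an affine chart $\mathbb{A}^r \subset \mathbb{P}^r$. Let $P_1, \ldots, P_n$ be distinct $\mathbb{F}_q$-rational points of $X$ lying in this affine chart and not in the support of $G$, and let $D := P_1 + \cdots + P_n$. Let $d$ be the minimum distance of the code $C(D,G)^*$, let $c$ be a codeword of weight $d$, and let $\{P_{i_1}, \ldots, P_{i_d}\}$ be the points $P_i$ for which $c_i \neq 0$. Then: (i) If $d \le m+2$, then $d = m+2$ and the $m+2$ points $P_{i_j}$ are collinear in $\mathbb{P}^r$. (ii) If $d \le 2m+2$ and no $m+2$ of the points $P_{i_j}$ are collinear, then $d = 2m+2$ and all the $2m+2$ points $P_{i_j}$ lie on a conic contained in a plane of $\mathbb{P}^r$. (iii) If $d \le 3m$, no $m+2$ of the points $P_{i_j}$ are collinear and no $2m+2$ of them lie on a plane conic, then $d = 3m$ and there exist a plane $\Pi \subset \mathbb{P}^r$ and two curves $C_3, C_m \subset \Pi$ of respective degrees $3$ and $m$ such that all the $3m$ points $P_{i_j}$ lie in $C_3 \cap C_m$.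
   Context: For a divisor $G$ on $X$, $L(G)$ denotes the Riemann–Roch space of rational functions $f$ on $X$ with $f = 0$ or $\mathrm{div}(f) + G \ge 0$. For $D = P_1+\cdots+P_n$ with the $P_i$ outside the support of $G$, $C(D,G)$ is the evaluation code $\{(f(P_1),\ldots,f(P_n)) : f \in L(G)\} \subseteq \mathbb{F}_q^n$, and $C(D,G)^*$ is its dual code, i.e. the set of $c \in \mathbb{F}_q^n$ with $\sum_{i=1}^n c_i f(P_i) = 0$ for all $f \in L(G)$. The weight of a codeword is its number of nonzero coordinates, and the minimum distance is the minimum weight of a nonzero codeword. *)

theory Defs
  imports Main
begin

text \<open>Points of the affine chart A^r are functions 'r => 'a, with 'r a finite index type
  of cardinality r. Vectors of F_q^n are functions nat => 'a vanishing outside {..<n}.\<close>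

definition monomials :: "nat \<Rightarrow> ('r::finite \<Rightarrow> nat) set" where
  "monomials m = {\<alpha>. sum \<alpha> UNIV \<le> m}"

definition mpoly_eval :: "nat \<Rightarrow> (('r::finite \<Rightarrow> nat) \<Rightarrow> 'a::field) \<Rightarrow> ('r \<Rightarrow> 'a) \<Rightarrow> 'a" where
  "mpoly_eval m a x = (\<Sum>\<alpha>\<in>monomials m. a \<alpha> * (\<Prod>j\<in>UNIV. x j ^ \<alpha> j))"

text \<open>Evaluation code C(D,G): L is the Riemann-Roch space, ev f x the value of f at x.\<close>
definition eval_code :: "'f set \<Rightarrow> ('f \<Rightarrow> ('r \<Rightarrow> 'a) \<Rightarrow> 'a::zero) \<Rightarrow> (nat \<Rightarrow> 'r \<Rightarrow> 'a) \<Rightarrow> nat \<Rightarrow> (nat \<Rightarrow> 'a) set" where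
  "eval_code L ev P n = {c. \<exists>f\<in>L. \<forall>i. c i = (if i < n then ev f (P i) else 0)}"

definition dual_code :: "nat \<Rightarrow> (nat \<Rightarrow> 'a::comm_ring) set \<Rightarrow> (nat \<Rightarrow> 'a) set" where
  "dual_code n C = {c. (\<forall>i\<ge>n. c i = 0) \<and> (\<forall>v\<in>C. (\<Sum>i<n. c i * v i) = 0)}"

definition weight :: "nat \<Rightarrow> (nat \<Rightarrow> 'a::zero) \<Rightarrow> nat" where
  "weight n c = card {i. i < n \<and> c i \<noteq> 0}"

definition min_distance :: "nat \<Rightarrow> (nat \<Rightarrow> 'a::zero) set \<Rightarrow> nat" where
  "min_distance n C = (LEAST w. \<exists>c\<in>C. c \<noteq> (\<lambda>_. 0) \<and> weight n c = w)"

definition collinear_pts :: "('r \<Rightarrow> 'a::field) set \<Rightarrow> bool" where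
  "collinear_pts S = (\<exists>p v. \<forall>x\<in>S. \<exists>t. \<forall>j. x j = p j + t * v j)"

definition lin_indep2 :: "('r \<Rightarrow> 'a::field) \<Rightarrow> ('r \<Rightarrow> 'a) \<Rightarrow> bool" where
  "lin_indep2 u w = (\<forall>a b. (\<forall>j. a * u j + b * w j = 0) \<longrightarrow> a = 0 \<and> b = 0)"

text \<open>Bivariate polynomial of total degree at most k (affine equation, in plane coordinates
  (s,t), of a plane curve of degree k), by coefficients a i j of s^i t^j.\<close>
definition bpoly_eval :: "nat \<Rightarrow> (nat \<Rightarrow> nat \<Rightarrow> 'a::field) \<Rightarrow> 'a \<Rightarrow> 'a \<Rightarrow> 'a" where
  "bpoly_eval k a s t = (\<Sum>i\<le>k. \<Sum>j\<le>k. if i + j \<le> k then a i j * s ^ i * t ^ j else 0)"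

definition bpoly_nonzero :: "nat \<Rightarrow> (nat \<Rightarrow> nat \<Rightarrow> 'a::zero) \<Rightarrow> bool" where
  "bpoly_nonzero k a = (\<exists>i j. i + j \<le> k \<and> a i j \<noteq> 0)"

definition in_plane_at :: "('r \<Rightarrow> 'a::field) \<Rightarrow> ('r \<Rightarrow> 'a) \<Rightarrow> ('r \<Rightarrow> 'a) \<Rightarrow> ('r \<Rightarrow> 'a) \<Rightarrow> 'a \<Rightarrow> 'a \<Rightarrow> bool" where
  "in_plane_at p u w x s t = (\<forall>j. x j = p j + s * u j + t * w j)"

definition on_plane_curve :: "nat \<Rightarrow> ('r \<Rightarrow> 'a::field) set \<Rightarrow> bool" where
  "on_plane_curve k S = (\<exists>p u w a. lin_indep2 u w \<and> bpoly_nonzero k a \<and>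
      (\<forall>x\<in>S. \<exists>s t. in_plane_at p u w x s t \<and> bpoly_eval k a s t = 0))"

end

theory Submission
  imports Defs "HOL-Computational_Algebra.Polynomial" "HOL-Library.FuncSet"
begin

text \<open>
  The support \<open>S\<close> of a codeword of the dual code satisfies a Cayley--Bacharach condition: there is
  a nowhere vanishing \<open>c\<close> on \<open>S\<close> with \<open>\<Sum>x\<in>S. c x * f x = 0\<close> for all \<open>f\<close> of degree at most \<open>m\<close>.
  If \<open>f\<close> has degree \<open>k \<le> m\<close>, then the points of \<open>S\<close> off the zero set of \<open>f\<close> satisfy the condition
  in degree \<open>m - k\<close>, with weights \<open>c * f\<close>. Taking residuals with respect to hyperplanes shows that
  \<open>S\<close> has at least \<open>m + 2\<close> points, is collinear if it has at most \<open>2 * m + 1\<close>, and lies in a plane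
  unless one of the line or conic configurations occurs. In the plane, residuals with respect to
  conics through five and cubics through nine points of \<open>S\<close> (which exist by a dimension count, here
  by the pigeonhole principle over the finite field) give the conic and the cubic. The remaining
  point, that \<open>3 * m - 1\<close> points without three on a line do not occur, rests on the Hilbert function
  of \<open>S\<close>: by Macaulay's bound its first difference cannot increase once it drops to \<open>2\<close>, while
  residuals force it to grow by at least \<open>5\<close> in any two consecutive steps; so it is at least
  \<open>3 * (m - 1)\<close> in degree \<open>m - 1\<close>, and some residual of degree \<open>m - 1\<close> has at most three points.

  The curve of degree \<open>m\<close> in (iii) may share components with the cubic; since \<open>m \<ge> 3\<close> there, the
  cubic itself serves.
\<close>

section \<open>Cayley--Bacharach sets\<close>

lemma two_elements:
  assumes "2 \<le> card S"
  shows "\<exists>x\<in>S. \<exists>y\<in>S. x \<noteq> y"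
proof -
  have "finite S" using assms by (auto intro: card_ge_0_finite)
  moreover have "\<not> card S \<le> Suc 0" using assms by simp
  ultimately show ?thesis using card_le_Suc0_iff_eq by blast
qed

text \<open>Instantiated twice: with bivariate polynomials in plane coordinates (\<open>bv\<close>)
  and with polynomial functions on affine space (\<open>pf\<close>). The counting arguments of this
  section serve both.\<close>

locale graded_functions =
  fixes D :: "nat \<Rightarrow> ('x \<Rightarrow> 'a::field) set"
  assumes one_mem: "(\<lambda>_. 1) \<in> D k"
    and mult_mem: "f \<in> D k \<Longrightarrow> g \<in> D l \<Longrightarrow> (\<lambda>x. f x * g x) \<in> D (k + l)"
    and separates: "x \<noteq> y \<Longrightarrow> \<exists>f\<in>D 1. f x = 0 \<and> f y \<noteq> 0"
begin

text \<open>The empty set qualifies, so passing to residuals needs no case distinction; lower bounds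
  on cardinalities assume \<open>S \<noteq> {}\<close> instead.\<close>

definition cayley_bacharach :: "nat \<Rightarrow> 'x set \<Rightarrow> bool" where
  "cayley_bacharach m S \<longleftrightarrow>
     finite S \<and> (\<exists>c. (\<forall>x\<in>S. c x \<noteq> 0) \<and> (\<forall>f\<in>D m. (\<Sum>x\<in>S. c x * f x) = 0))"

lemma cayley_bacharach_finite: "cayley_bacharach m S \<Longrightarrow> finite S"
  by (simp add: cayley_bacharach_def)

lemma cayley_bacharach_residual:
  assumes S: "cayley_bacharach m S" and f: "f \<in> D k" and k: "k \<le> m"
  shows "cayley_bacharach (m - k) {x \<in> S. f x \<noteq> 0}"
proof -
  from S obtain c where fin: "finite S" and c: "\<forall>x\<in>S. c x \<noteq> 0"
    and z: "\<And>f. f \<in> D m \<Longrightarrow> (\<Sum>x\<in>S. c x * f x) = 0"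
    by (auto simp: cayley_bacharach_def)
  have "(\<Sum>x | x \<in> S \<and> f x \<noteq> 0. (c x * f x) * g x) = 0" if g: "g \<in> D (m - k)" for g
  proof -
    have "(\<lambda>x. f x * g x) \<in> D m"
      using mult_mem[OF f g] k by simp
    from z[OF this] have "(\<Sum>x\<in>S. c x * (f x * g x)) = 0" .
    moreover have "(\<Sum>x\<in>S. c x * (f x * g x)) = (\<Sum>x | x \<in> S \<and> f x \<noteq> 0. (c x * f x) * g x)"
      by (rule sum.mono_neutral_cong_right) (use fin in \<open>auto simp: mult.assoc\<close>)
    ultimately show ?thesis by simp
  qed
  then show ?thesis
    unfolding cayley_bacharach_def
    using fin c by (intro conjI exI[of _ "\<lambda>x. c x * f x"]) auto
qed

lemma cayley_bacharach_card_ge_2: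
  assumes "cayley_bacharach m S" "S \<noteq> {}"
  shows "2 \<le> card S"
proof (rule ccontr)
  assume "\<not> 2 \<le> card S"
  moreover have "finite S" using assms by (rule_tac cayley_bacharach_finite)
  ultimately have "card S = 1" using assms(2) card_gt_0_iff[of S] by linarith
  then obtain x where x: "S = {x}" by (rule card_1_singletonE)
  obtain c where "c x \<noteq> 0" "\<And>f. f \<in> D m \<Longrightarrow> c x * f x = 0"
    using assms(1) by (auto simp: cayley_bacharach_def x)
  from this(1) this(2)[OF one_mem] show False by simp
qed

text \<open>A degree 1 function through one point of \<open>S\<close> but not through another leaves
  a nonempty residual that satisfies the condition in one degree less and has lost at least one
  point.\<close>

lemma cayley_bacharach_card_ge:
  assumes "cayley_bacharach m S" "S \<noteq> {}"
  shows "m + 2 \<le> card S"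
  using assms
proof (induction m arbitrary: S)
  case 0
  then show ?case using cayley_bacharach_card_ge_2[of 0 S] by simp
next
  case (Suc m)
  have fin: "finite S" using Suc.prems cayley_bacharach_finite by blast
  have "2 \<le> card S" using Suc.prems cayley_bacharach_card_ge_2 by blast
  then obtain x y where xy: "x \<in> S" "y \<in> S" "x \<noteq> y"
    using two_elements by blast
  then obtain f where f: "f \<in> D 1" "f x = 0" "f y \<noteq> 0" using separates by blast
  let ?T = "{x \<in> S. f x \<noteq> 0}"
  have "cayley_bacharach m ?T"
    using cayley_bacharach_residual[OF Suc.prems(1) f(1)] by simp
  moreover have "?T \<noteq> {}" using xy f by auto
  ultimately have "m + 2 \<le> card ?T" using Suc.IH by blast
  moreover have "card ?T < card S" using fin xy f by (intro psubset_card_mono) auto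
  ultimately show ?case by simp
qed

text \<open>A coordinate-free form of collinearity, available in both instances. The points
  \<open>a\<close> and \<open>b\<close> may coincide or lie outside \<open>S\<close>, so empty sets
  and single points are covered.\<close>

definition on_line :: "'x set \<Rightarrow> bool" where
  "on_line S \<longleftrightarrow> (\<exists>a b. \<forall>g\<in>D 1. g a = 0 \<longrightarrow> g b = 0 \<longrightarrow> (\<forall>x\<in>S. g x = 0))"

text \<open>If \<open>S\<close> is not on a line, the residual \<open>T\<close> of a function
  through two points is small enough to lie on a line by induction. A second function vanishing on
  that line has a residual \<open>U\<close> disjoint from \<open>T\<close>. In the step to
  \<open>Suc m\<close>, each has at least \<open>m + 2\<close> points, together more than the
  \<open>2 * m + 3\<close> allowed.\<close>

lemma cayley_bacharach_on_line:
  assumes "cayley_bacharach m S" "card S \<le> 2 * m + 1"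
  shows "on_line S"
  using assms
proof (induction m arbitrary: S)
  case 0
  have "S = {}" using cayley_bacharach_card_ge_2[OF 0(1)] 0(2) by (cases "S = {}") auto
  then show ?case by (auto simp: on_line_def)
next
  case (Suc m)
  note fin = cayley_bacharach_finite[OF Suc.prems(1)]
  show ?case
  proof (rule ccontr)
    assume nl: "\<not> on_line S"
    then have ne: "S \<noteq> {}" by (auto simp: on_line_def)
    have "2 \<le> card S" using cayley_bacharach_card_ge_2[OF Suc.prems(1) ne] .
    then obtain x y where xy: "x \<in> S" "y \<in> S" "x \<noteq> y"
    using two_elements by blast
    obtain g where g: "g \<in> D 1" "g x = 0" "g y = 0" "\<exists>z\<in>S. g z \<noteq> 0"
      using nl unfolding on_line_def by blast
    let ?T = "{x \<in> S. g x \<noteq> 0}"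
    have cT: "cayley_bacharach m ?T"
      using cayley_bacharach_residual[OF Suc.prems(1) g(1)] by simp
    have "card ?T \<le> card (S - {x, y})" using fin g by (intro card_mono) auto
    also have "\<dots> = card S - 2" using fin xy by (simp add: card_Diff_subset)
    finally have "card ?T \<le> 2 * m + 1" using Suc.prems(2) by simp
    then have "on_line ?T" using Suc.IH cT by blast
    then obtain a b where ab: "\<And>g x. g \<in> D 1 \<Longrightarrow> g a = 0 \<Longrightarrow> g b = 0 \<Longrightarrow> x \<in> ?T \<Longrightarrow> g x = 0"
      unfolding on_line_def by blast
    obtain h where h: "h \<in> D 1" "h a = 0" "h b = 0" "\<exists>z\<in>S. h z \<noteq> 0"
      using nl unfolding on_line_def by blast
    let ?U = "{x \<in> S. h x \<noteq> 0}"
    have cU: "cayley_bacharach m ?U"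
      using cayley_bacharach_residual[OF Suc.prems(1) h(1)] by simp
    have "m + 2 \<le> card ?T" using cayley_bacharach_card_ge[OF cT] g by blast
    moreover have "m + 2 \<le> card ?U" using cayley_bacharach_card_ge[OF cU] h by blast
    moreover have "card ?T + card ?U \<le> card S"
    proof -
      have "?T \<inter> ?U = {}" using ab[OF h(1-3)] by auto
      then have "card ?T + card ?U = card (?T \<union> ?U)" using fin by (simp add: card_Un_disjoint)
      also have "\<dots> \<le> card S" using fin by (intro card_mono) auto
      finally show ?thesis .
    qed
    ultimately show False using Suc.prems(2) by simp
  qed
qed

text \<open>Since \<open>m + 2 \<le> 2 * m + 1\<close> for positive \<open>m\<close>, the only new
  case is a pair of points with \<open>m = 0\<close>.\<close>

lemma cayley_bacharach_on_line':
  assumes "cayley_bacharach m S" "card S \<le> m + 2"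
  shows "on_line S"
proof (cases "m = 0")
  case False
  then show ?thesis using assms by (intro cayley_bacharach_on_line) auto
next
  case True
  note fin = cayley_bacharach_finite[OF assms(1)]
  consider "S = {}" | "card S = 2"
    using cayley_bacharach_card_ge_2[OF assms(1)] assms(2) True by (cases "S = {}") auto
  then show ?thesis by cases (auto simp: on_line_def card_2_iff)
qed

end

section \<open>Bivariate polynomials as iterated univariate polynomials\<close>

text \<open>In \<open>'a poly poly\<close> the outer variable is the first coordinate \<open>s\<close>, the inner one is \<open>t\<close>.\<close>
definition bivar :: "nat \<Rightarrow> 'a::field poly poly set" where
  "bivar k = {p. \<forall>i j. coeff (coeff p i) j \<noteq> 0 \<longrightarrow> i + j \<le> k}"

definition ev2 :: "'a::field poly poly \<Rightarrow> 'a \<times> 'a \<Rightarrow> 'a" where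
  "ev2 p x = poly (poly p [:fst x:]) (snd x)"

text \<open>The two variables act by \<open>pCons 0\<close> (multiplication by \<open>s\<close>) and
  by \<open>smult (pCons 0 [:1:])\<close> (multiplication by \<open>t\<close>); the last two rules
  evaluate these shifts.\<close>

lemma ev2_simps [simp]:
  "ev2 0 x = 0" "ev2 1 x = 1"
  "ev2 (p + q) x = ev2 p x + ev2 q x"
  "ev2 (p - q) x = ev2 p x - ev2 q x"
  "ev2 (- p) x = - ev2 p x"
  "ev2 (p * q) x = ev2 p x * ev2 q x"
  "ev2 (smult [:a:] p) x = a * ev2 p x"
  "ev2 (pCons 0 p) x = fst x * ev2 p x"
  "ev2 (smult (pCons 0 [:1:]) p) x = snd x * ev2 p x"
  by (simp_all add: ev2_def)

lemma ev2_sum: "ev2 (\<Sum>i\<in>A. f i) x = (\<Sum>i\<in>A. ev2 (f i) x)"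
  by (simp add: ev2_def poly_sum)

lemma bivar_coeff_eq_0: "p \<in> bivar k \<Longrightarrow> k < i + j \<Longrightarrow> coeff (coeff p i) j = 0"
  unfolding bivar_def by force

lemma bivarI: "(\<And>i j. k < i + j \<Longrightarrow> coeff (coeff p i) j = 0) \<Longrightarrow> p \<in> bivar k"
  unfolding bivar_def by (force simp: not_less[symmetric])

lemma bivar_mono: "k \<le> l \<Longrightarrow> bivar k \<subseteq> bivar l"
  unfolding bivar_def by force

lemma bivar_0 [simp]: "0 \<in> bivar k"
  by (simp add: bivar_def)

lemma bivar_1 [simp]: "1 \<in> bivar k"
  by (rule bivarI) (auto simp: one_pCons coeff_pCons split: nat.splits)

lemma bivar_add: "p \<in> bivar k \<Longrightarrow> q \<in> bivar k \<Longrightarrow> p + q \<in> bivar k"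
  by (rule bivarI) (simp add: bivar_coeff_eq_0)

lemma bivar_diff: "p \<in> bivar k \<Longrightarrow> q \<in> bivar k \<Longrightarrow> p - q \<in> bivar k"
  by (rule bivarI) (simp add: bivar_coeff_eq_0)

lemma bivar_smult: "p \<in> bivar k \<Longrightarrow> smult [:a:] p \<in> bivar k"
  by (rule bivarI) (simp add: bivar_coeff_eq_0)

lemma bivar_sum: "(\<And>i. i \<in> A \<Longrightarrow> f i \<in> bivar k) \<Longrightarrow> (\<Sum>i\<in>A. f i) \<in> bivar k"
  by (induction A rule: infinite_finite_induct) (auto intro: bivar_add)

lemma bivar_mult:
  assumes "p \<in> bivar k" "q \<in> bivar l"
  shows "p * q \<in> bivar (k + l)"
proof (rule bivarI)
  fix i j assume ij: "k + l < i + j"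
  have "coeff (coeff p a * coeff q (i - a)) j = 0" if "a \<le> i" for a
    unfolding coeff_mult
  proof (rule sum.neutral, rule ballI)
    fix b assume "b \<in> {..j}"
    then have "k < a + b \<or> l < (i - a) + (j - b)" using ij that by auto
    then show "coeff (coeff p a) b * coeff (coeff q (i - a)) (j - b) = 0"
      using assms by (auto simp: bivar_coeff_eq_0)
  qed
  then show "coeff (coeff (p * q) i) j = 0"
    by (simp add: coeff_mult[of p q] coeff_sum)
qed

lemma bivar_X: "p \<in> bivar k \<Longrightarrow> pCons 0 p \<in> bivar (Suc k)"
  by (rule bivarI) (auto simp: coeff_pCons bivar_coeff_eq_0 split: nat.splits)

lemma bivar_Y: "p \<in> bivar k \<Longrightarrow> smult (pCons 0 [:1:]) p \<in> bivar (Suc k)"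
  by (rule bivarI) (auto simp: coeff_pCons bivar_coeff_eq_0 split: nat.splits)

lemma bivar_X_cancel: "pCons 0 p \<in> bivar (Suc k) \<Longrightarrow> p \<in> bivar k"
  by (rule bivarI) (auto dest: bivar_coeff_eq_0[where i = "Suc _"])

lemma poly_eq_sum_atMost:
  fixes p :: "'a::comm_semiring_1 poly"
  assumes "degree p \<le> n"
  shows "poly p x = (\<Sum>i\<le>n. coeff p i * x ^ i)"
proof -
  have "(\<Sum>i\<le>degree p. coeff p i * x ^ i) = (\<Sum>i\<le>n. coeff p i * x ^ i)"
    using assms by (intro sum.mono_neutral_left) (auto simp: coeff_eq_0)
  then show ?thesis by (simp add: poly_altdef)
qed

lemma ev2_eq_sum:
  assumes "p \<in> bivar k"
  shows "ev2 p (s, t) = (\<Sum>i\<le>k. \<Sum>j\<le>k. coeff (coeff p i) j * s ^ i * t ^ j)"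
proof -
  have "coeff p i = 0" if "k < i" for i
    using that assms by (intro poly_eqI) (simp add: bivar_coeff_eq_0)
  then have dp: "degree p \<le> k" by (intro degree_le) auto
  have dc: "degree (coeff p i) \<le> k" for i
    using assms by (intro degree_le) (auto simp: bivar_coeff_eq_0)
  have "ev2 p (s, t) = (\<Sum>i\<le>k. poly (coeff p i) t * s ^ i)"
    by (simp add: ev2_def poly_eq_sum_atMost[OF dp] poly_sum poly_power)
  also have "\<dots> = (\<Sum>i\<le>k. \<Sum>j\<le>k. coeff (coeff p i) j * s ^ i * t ^ j)"
    by (simp add: poly_eq_sum_atMost[OF dc] sum_distrib_left sum_distrib_right mult_ac)
  finally show ?thesis .
qed

lemma ev2_eq_bpoly_eval:
  assumes "p \<in> bivar k"
  shows "bpoly_eval k (\<lambda>i j. coeff (coeff p i) j) s t = ev2 p (s, t)"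
  unfolding bpoly_eval_def ev2_eq_sum[OF assms]
  using assms by (intro sum.cong refl) (auto simp: bivar_coeff_eq_0)

lemma bpoly_nonzero_coeff:
  assumes "p \<in> bivar k" "p \<noteq> 0"
  shows "bpoly_nonzero k (\<lambda>i j. coeff (coeff p i) j)"
proof -
  obtain i j where "coeff (coeff p i) j \<noteq> 0"
    using assms(2) by (metis coeff_0 poly_eqI)
  then show ?thesis using assms(1) unfolding bpoly_nonzero_def bivar_def by blast
qed

interpretation bv: graded_functions "\<lambda>k. ev2 ` (bivar k :: 'a::field poly poly set)"
proof
  fix k :: nat
  show "(\<lambda>_. 1) \<in> ev2 ` (bivar k :: 'a::field poly poly set)"
    by (rule image_eqI[of _ _ 1]) auto
next
  fix f g :: "'a \<times> 'a \<Rightarrow> 'a" and k l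
  assume "f \<in> ev2 ` bivar k" "g \<in> ev2 ` bivar l"
  then obtain p q where "p \<in> bivar k" "q \<in> bivar l" "f = ev2 p" "g = ev2 q" by blast
  then show "(\<lambda>x. f x * g x) \<in> ev2 ` bivar (k + l)"
    by (intro image_eqI[of _ _ "p * q"]) (auto intro: bivar_mult)
next
  fix x y :: "'a \<times> 'a"
  assume "x \<noteq> y"
  then consider "fst x \<noteq> fst y" | "snd x \<noteq> snd y" by (metis prod_eqI)
  then show "\<exists>f\<in>ev2 ` bivar 1. f x = 0 \<and> f y \<noteq> 0"
  proof cases
    case 1
    \<comment> \<open>The polynomial \<open>s - fst x\<close>; the other case uses
      \<open>t - snd x\<close>.\<close>
    have "[:[:- fst x:], 1:] \<in> bivar 1"
      by (rule bivarI) (auto simp: coeff_pCons split: nat.splits)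
    then show ?thesis
      by (rule_tac bexI[of _ "ev2 [:[:- fst x:], 1:]"]) (use 1 in \<open>auto simp: ev2_def\<close>)
  next
    case 2
    have "[:[:- snd x, 1:]:] \<in> bivar 1"
      by (rule bivarI) (auto simp: coeff_pCons split: nat.splits)
    then show ?thesis
      by (rule_tac bexI[of _ "ev2 [:[:- snd x, 1:]:]"]) (use 2 in \<open>auto simp: ev2_def\<close>)
  qed
qed

section \<open>Counting bivariate polynomials over a finite field\<close>

definition triangle :: "nat \<Rightarrow> nat" where
  "triangle k = card {(i, j). i + j \<le> k}"

lemma finite_triangle: "finite {(i, j). i + j \<le> (k::nat)}"
  by (rule finite_subset[of _ "{..k} \<times> {..k}"]) auto

lemma triangle_Suc: "triangle (Suc k) = triangle k + k + 2"
proof -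
  have "{(i, j). i + j \<le> Suc k} = {(i, j). i + j \<le> k} \<union> (\<lambda>i. (i, Suc k - i)) ` {..Suc k}"
    by (auto simp: image_iff)
  moreover have "card ((\<lambda>i. (i, Suc k - i)) ` {..Suc k}) = k + 2"
    by (subst card_image) (auto simp: inj_on_def)
  ultimately show ?thesis
    unfolding triangle_def
    by (simp only:) (subst card_Un_disjoint, auto simp: finite_triangle)
qed

lemma triangle_0: "triangle 0 = 1"
proof -
  have "{(i, j). i + j \<le> (0::nat)} = {(0, 0)}" by auto
  then show ?thesis by (simp add: triangle_def)
qed

lemma triangle_numerals: "triangle 1 = 3" "triangle 2 = 6" "triangle 3 = 10"
  using triangle_Suc[of 0] triangle_Suc[of 1] triangle_Suc[of 2]
  by (simp_all add: triangle_0 numeral_2_eq_2 numeral_3_eq_3)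

text \<open>Turns dimensions into cardinalities: over a field with \<open>q\<close> elements a space
  of dimension \<open>n\<close> has \<open>q ^ n\<close> elements, and all linear algebra below is
  carried out by such counts.\<close>

lemma bij_betw_bivar_coeffs:
  "bij_betw (\<lambda>p. restrict (\<lambda>(i, j). coeff (coeff p i) j) {(i, j). i + j \<le> k})
     (bivar k :: 'a::field poly poly set) ({(i, j). i + j \<le> k} \<rightarrow>\<^sub>E UNIV)"
  (is "bij_betw ?F _ _")
proof -
  let ?I = "{(i, j). i + j \<le> k}"
  have "inj_on ?F (bivar k)"
  proof (rule inj_onI)
    fix p q :: "'a poly poly"
    assume p: "p \<in> bivar k" and q: "q \<in> bivar k" and eq: "?F p = ?F q"
    have "coeff (coeff p i) j = coeff (coeff q i) j" for i j
    proof (cases "i + j \<le> k")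
      case True
      then show ?thesis using fun_cong[OF eq, of "(i, j)"] by simp
    next
      case False
      then show ?thesis using p q by (simp add: bivar_coeff_eq_0)
    qed
    then show "p = q" by (intro poly_eqI)
  qed
  moreover have "?F ` bivar k = ?I \<rightarrow>\<^sub>E UNIV"
  proof (intro equalityI subsetI)
    fix a :: "nat \<times> nat \<Rightarrow> 'a"
    assume a: "a \<in> ?I \<rightarrow>\<^sub>E UNIV"
    define p where "p = (\<Sum>x\<in>?I. monom (monom (a x) (snd x)) (fst x))"
    have co: "coeff (coeff p i) j = (if i + j \<le> k then a (i, j) else 0)" for i j
    proof -
      have "coeff (coeff p i) j = (\<Sum>x\<in>?I. if x = (i, j) then a x else 0)"
        unfolding p_def coeff_sum by (intro sum.cong) (auto split: if_splits)
      then show ?thesis by (simp add: sum.delta finite_triangle)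
    qed
    then have "p \<in> bivar k" by (intro bivarI) simp
    moreover have "?F p = a"
      using a by (intro ext) (auto simp: co restrict_def PiE_def extensional_def)
    ultimately show "a \<in> ?F ` bivar k" by blast
  qed (auto split: if_splits)
  ultimately show ?thesis by (simp add: bij_betw_def)
qed

lemma finite_bivar [simp]: "finite (bivar k :: 'a::{field,finite} poly poly set)"
  using bij_betw_finite[OF bij_betw_bivar_coeffs[of k, where 'a = 'a]]
  by (simp add: finite_PiE finite_triangle)

lemma card_bivar:
  "card (bivar k :: 'a::{field,finite} poly poly set) = card (UNIV :: 'a set) ^ triangle k"
  using bij_betw_same_card[OF bij_betw_bivar_coeffs[of k, where 'a = 'a]]
  by (simp add: card_PiE finite_triangle triangle_def)

lemma card_field_ge_2: "2 \<le> card (UNIV :: 'a::{field,finite} set)"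
proof -
  have "card {0, 1 :: 'a} \<le> card (UNIV :: 'a set)" by (intro card_mono) auto
  then show ?thesis by simp
qed

definition vanish :: "nat \<Rightarrow> ('a::field \<times> 'a) set \<Rightarrow> 'a poly poly set" where
  "vanish k S = {p \<in> bivar k. \<forall>x\<in>S. ev2 p x = 0}"

text \<open>There are more polynomials in \<open>bivar k\<close> than value tables on
  \<open>T\<close>, so two distinct ones agree on \<open>T\<close>; their difference is the required
  polynomial.\<close>

lemma exists_vanishing:
  fixes T :: "('a::{field,finite} \<times> 'a) set"
  assumes "finite T" "card T < triangle k"
  shows "\<exists>p\<in>bivar k. p \<noteq> 0 \<and> (\<forall>x\<in>T. ev2 p x = 0)"
proof -
  have "card (T \<rightarrow>\<^sub>E (UNIV :: 'a set)) < card (bivar k :: 'a poly poly set)"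
    using assms card_field_ge_2[where 'a = 'a] by (simp add: card_PiE card_bivar)
  moreover have "(\<lambda>p. restrict (ev2 p) T) ` bivar k \<subseteq> T \<rightarrow>\<^sub>E (UNIV :: 'a set)" by auto
  ultimately have "\<not> inj_on (\<lambda>p. restrict (ev2 p) T) (bivar k)"
    using assms(1) by (meson card_inj_on_le finite_PiE finite linorder_not_le)
  then obtain p q where pq: "p \<in> bivar k" "q \<in> bivar k" "p \<noteq> q"
    "restrict (ev2 p) T = restrict (ev2 q) T"
    by (auto simp: inj_on_def)
  have "ev2 p x = ev2 q x" if "x \<in> T" for x
    using fun_cong[OF pq(4), of x] that by simp
  then show ?thesis
    using pq by (intro bexI[of _ "p - q"]) (auto intro: bivar_diff)
qed

section \<open>Hilbert functions of plane point sets\<close>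

text \<open>Linear independence of the evaluations at the points of \<open>B\<close>, encoded by a
  separator for each point, that is, a polynomial nonzero there and zero at the other points of
  \<open>B\<close>.\<close>

definition independent_conditions :: "nat \<Rightarrow> ('a::field \<times> 'a) set \<Rightarrow> bool" where
  "independent_conditions k B \<longleftrightarrow>
     finite B \<and> (\<forall>y\<in>B. \<exists>p\<in>bivar k. ev2 p y \<noteq> 0 \<and> (\<forall>x\<in>B - {y}. ev2 p x = 0))"

lemma interpolation:
  assumes "independent_conditions k B"
  shows "\<exists>p\<in>bivar k. \<forall>x\<in>B. ev2 p x = v x"
proof -
  have fin: "finite B"
    and "\<forall>y\<in>B. \<exists>p\<in>bivar k. ev2 p y \<noteq> 0 \<and> (\<forall>x\<in>B - {y}. ev2 p x = 0)"
    using assms by (auto simp: independent_conditions_def)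
  then obtain d where d: "\<And>y. y \<in> B \<Longrightarrow> d y \<in> bivar k" "\<And>y. y \<in> B \<Longrightarrow> ev2 (d y) y \<noteq> 0"
    "\<And>x y. y \<in> B \<Longrightarrow> x \<in> B \<Longrightarrow> x \<noteq> y \<Longrightarrow> ev2 (d y) x = 0"
    by (metis Diff_iff singletonD)
  let ?p = "\<Sum>y\<in>B. smult [:v y / ev2 (d y) y:] (d y)"
  have "?p \<in> bivar k" by (intro bivar_sum bivar_smult d(1))
  moreover have "ev2 ?p x = v x" if "x \<in> B" for x
  proof -
    have "ev2 ?p x = (\<Sum>y\<in>B. if y = x then v x else 0)"
      unfolding ev2_sum using d that by (intro sum.cong) auto
    then show ?thesis using fin that by simp
  qed
  ultimately show ?thesis by blast
qed

lemma vanish_zero [simp]: "0 \<in> vanish k S"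
  by (simp add: vanish_def)

lemma vanish_add: "p \<in> vanish k S \<Longrightarrow> q \<in> vanish k S \<Longrightarrow> p + q \<in> vanish k S"
  by (simp add: vanish_def bivar_add)

lemma vanish_diff: "p \<in> vanish k S \<Longrightarrow> q \<in> vanish k S \<Longrightarrow> p - q \<in> vanish k S"
  by (simp add: vanish_def bivar_diff)

lemma vanish_X: "p \<in> vanish k S \<Longrightarrow> pCons 0 p \<in> vanish (Suc k) S"
  by (simp add: vanish_def bivar_X)

lemma vanish_Y: "p \<in> vanish k S \<Longrightarrow> smult (pCons 0 [:1:]) p \<in> vanish (Suc k) S"
  using bivar_Y[of p k] by (simp add: vanish_def del: pCons_0_0)

lemma vanish_mono: "k \<le> l \<Longrightarrow> vanish k S \<subseteq> vanish l S"
  using bivar_mono[of k l] by (auto simp: vanish_def)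

lemma finite_vanish [simp]: "finite (vanish k (S :: ('a::{field,finite} \<times> 'a) set))"
  unfolding vanish_def by simp

text \<open>The rank formula for evaluation at \<open>B\<close>. With an interpolating section
  \<open>e\<close>, every polynomial is uniquely a vanishing one plus \<open>e\<close> of its own
  values on \<open>B\<close>.\<close>

lemma card_vanish_independent:
  fixes B :: "('a::{field,finite} \<times> 'a) set"
  assumes "independent_conditions k B"
  shows "card (vanish k B) * card (UNIV :: 'a set) ^ card B = card (UNIV :: 'a set) ^ triangle k"
proof -
  have fin: "finite B" using assms by (simp add: independent_conditions_def)
  obtain e where e: "\<And>v. e v \<in> bivar k" "\<And>v x. x \<in> B \<Longrightarrow> ev2 (e v) x = v x"
    using interpolation[OF assms] by metis
  have "bij_betw (\<lambda>(p, v). p + e v) (vanish k B \<times> (B \<rightarrow>\<^sub>E UNIV)) (bivar k)"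
  proof (rule bij_betw_byWitness
      [where f' = "\<lambda>p. (p - e (restrict (ev2 p) B), restrict (ev2 p) B)"])
    have "restrict (ev2 (p + e v)) B = v" if "p \<in> vanish k B" "v \<in> B \<rightarrow>\<^sub>E UNIV" for p v
      using that by (intro ext) (auto simp: vanish_def e restrict_def PiE_def extensional_def)
    then show "\<forall>a\<in>vanish k B \<times> (B \<rightarrow>\<^sub>E UNIV).
        (case case a of (p, v) \<Rightarrow> p + e v of
          p \<Rightarrow> (p - e (restrict (ev2 p) B), restrict (ev2 p) B)) = a"
      by auto
  qed (auto simp: vanish_def e intro: bivar_add bivar_diff)
  from bij_betw_same_card[OF this] show ?thesis
    by (simp add: card_cartesian_product card_PiE fin card_bivar)
qed

text \<open>The polynomial \<open>p\<close> separates \<open>y\<close>; the old separators are made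
  to vanish at \<open>y\<close> by subtracting a multiple of \<open>p\<close>, which changes nothing
  on \<open>B\<close>.\<close>

lemma independent_conditions_insert:
  assumes B: "independent_conditions k B"
    and p: "p \<in> bivar k" "\<forall>x\<in>B. ev2 p x = 0" "ev2 p y \<noteq> 0"
  shows "independent_conditions k (insert y B)"
  unfolding independent_conditions_def
proof (intro conjI ballI)
  show "finite (insert y B)" using B by (simp add: independent_conditions_def)
next
  fix z assume z: "z \<in> insert y B"
  show "\<exists>q\<in>bivar k. ev2 q z \<noteq> 0 \<and> (\<forall>x\<in>insert y B - {z}. ev2 q x = 0)"
  proof (cases "z = y")
    case True
    then show ?thesis using p by blast
  next
    case False
    then obtain q where q: "q \<in> bivar k" "ev2 q z \<noteq> 0" "\<forall>x\<in>B - {z}. ev2 q x = 0"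
      using B z by (auto simp: independent_conditions_def)
    let ?q = "q - smult [:ev2 q y / ev2 p y:] p"
    have "?q \<in> bivar k" using q p by (intro bivar_diff bivar_smult)
    then show ?thesis using q p z False by (intro bexI[of _ ?q]) auto
  qed
qed

text \<open>Take an independent subset of greatest size: a polynomial vanishing on it but not at
  some \<open>y\<close> in \<open>S\<close> would allow \<open>y\<close> to be added.\<close>

lemma maximal_independent_exists:
  assumes "finite S"
  shows "\<exists>B\<subseteq>S. independent_conditions k B \<and> vanish k B = vanish k S"
proof -
  let ?Q = "\<lambda>B. B \<subseteq> S \<and> independent_conditions k B"
  have "?Q {}" by (simp add: independent_conditions_def)
  moreover have "\<forall>B. ?Q B \<longrightarrow> card B < Suc (card S)"
    using assms by (auto simp: less_Suc_eq_le intro: card_mono)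
  ultimately have "\<exists>B. ?Q B \<and> (\<forall>C. ?Q C \<longrightarrow> card C \<le> card B)"
    by (rule ex_has_greatest_nat)
  then obtain B where B: "?Q B" and max: "\<And>C. ?Q C \<Longrightarrow> card C \<le> card B" by blast
  have finB: "finite B" using B assms finite_subset by blast
  have "vanish k B \<subseteq> vanish k S"
  proof
    fix p assume p: "p \<in> vanish k B"
    have "ev2 p y = 0" if y: "y \<in> S" for y
    proof (rule ccontr)
      assume n: "ev2 p y \<noteq> 0"
      then have "?Q (insert y B)"
        using independent_conditions_insert[of k B p y] B p y by (auto simp: vanish_def)
      then have "card (insert y B) \<le> card B" by (rule max)
      moreover have "y \<notin> B" using p n by (auto simp: vanish_def)
      ultimately show False using finB by simp
    qed
    then show "p \<in> vanish k S" using p by (simp add: vanish_def)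
  qed
  moreover have "vanish k S \<subseteq> vanish k B" using B by (auto simp: vanish_def)
  ultimately show ?thesis using B by blast
qed

text \<open>The rank of evaluation at \<open>S\<close> in degree \<open>k\<close>. It does not
  depend on the chosen \<open>B\<close>, because \<open>card_vanish_independent\<close> determines
  \<open>card B\<close> from the number of polynomials vanishing on \<open>S\<close>.\<close>

definition hilbert_function :: "('a::field \<times> 'a) set \<Rightarrow> nat \<Rightarrow> nat" where
  "hilbert_function S k =
     card (SOME B. B \<subseteq> S \<and> independent_conditions k B \<and> vanish k B = vanish k S)"

lemma hilbert_function_witness:
  assumes "finite S"
  obtains B where "B \<subseteq> S" "independent_conditions k B" "vanish k B = vanish k S"
    "card B = hilbert_function S k"
proof -
  let ?B = "SOME B. B \<subseteq> S \<and> independent_conditions k B \<and> vanish k B = vanish k S"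
  have "?B \<subseteq> S \<and> independent_conditions k ?B \<and> vanish k ?B = vanish k S"
    using maximal_independent_exists[OF assms, of k] by (rule someI_ex)
  then show ?thesis using that[of ?B] by (simp add: hilbert_function_def)
qed

lemma card_vanish:
  fixes S :: "('a::{field,finite} \<times> 'a) set"
  assumes "finite S"
  shows "card (vanish k S) * card (UNIV :: 'a set) ^ hilbert_function S k
    = card (UNIV :: 'a set) ^ triangle k"
proof (rule hilbert_function_witness[OF assms, of k])
  fix B
  assume "independent_conditions k B" "vanish k B = vanish k S" "card B = hilbert_function S k"
  then show ?thesis using card_vanish_independent[of k B] by simp
qed

lemma hilbert_function_le_triangle:
  fixes S :: "('a::{field,finite} \<times> 'a) set"
  assumes "finite S"
  shows "hilbert_function S k \<le> triangle k"
proof -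
  let ?q = "card (UNIV :: 'a set)"
  have "vanish k S \<noteq> {}" using vanish_zero by blast
  then have "1 \<le> card (vanish k S)" by (simp add: Suc_le_eq card_gt_0_iff)
  then have "?q ^ hilbert_function S k \<le> card (vanish k S) * ?q ^ hilbert_function S k"
    using mult_le_mono1 by fastforce
  then show ?thesis
    using card_field_ge_2[where 'a = 'a] by (simp add: card_vanish[OF assms])
qed

lemma card_vanish_eq_power:
  fixes S :: "('a::{field,finite} \<times> 'a) set"
  assumes "finite S"
  shows "card (vanish k S) = card (UNIV :: 'a set) ^ (triangle k - hilbert_function S k)"
proof -
  let ?q = "card (UNIV :: 'a set)"
  have "?q ^ triangle k = ?q ^ (triangle k - hilbert_function S k) * ?q ^ hilbert_function S k"
    using hilbert_function_le_triangle[OF assms, of k] by (simp flip: power_add)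
  then show ?thesis using card_vanish[OF assms, of k] card_field_ge_2[where 'a = 'a] by simp
qed

text \<open>Fewer polynomials vanish on \<open>S\<close> than on \<open>B\<close>, or equally many;
  the rank formula on both sides compares the exponents.\<close>

lemma independent_card_le_hilbert_function:
  fixes S :: "('a::{field,finite} \<times> 'a) set"
  assumes "finite S" "B \<subseteq> S" "independent_conditions k B"
  shows "card B \<le> hilbert_function S k"
proof -
  let ?q = "card (UNIV :: 'a set)"
  have "card (vanish k S) \<le> card (vanish k B)"
    using assms(2) by (intro card_mono) (auto simp: vanish_def)
  then have "card (vanish k S) * ?q ^ card B \<le> card (vanish k S) * ?q ^ hilbert_function S k"
    by (simp add: card_vanish[OF assms(1)] flip: card_vanish_independent[OF assms(3)])
  moreover have "card (vanish k S) \<noteq> 0" by (auto simp: card_eq_0_iff intro: vanish_zero)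
  ultimately show ?thesis using card_field_ge_2[where 'a = 'a] by simp
qed

lemma hilbert_function_eq_triangle:
  fixes S :: "('a::{field,finite} \<times> 'a) set"
  assumes "finite S" "\<And>p. p \<in> bivar k \<Longrightarrow> p \<noteq> 0 \<Longrightarrow> \<exists>x\<in>S. ev2 p x \<noteq> 0"
  shows "hilbert_function S k = triangle k"
proof -
  have "vanish k S = {0}" using assms(2) by (auto simp: vanish_def)
  then have "card (UNIV :: 'a set) ^ hilbert_function S k = card (UNIV :: 'a set) ^ triangle k"
    using card_vanish[OF assms(1), of k] by simp
  then show ?thesis
    using card_field_ge_2[where 'a = 'a] by (subst (asm) power_inject_exp) auto
qed

text \<open>If \<open>Y * f\<close> were in \<open>X * V + V\<close> for all \<open>f \<in> V\<close>, then comparing leading forms would make the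
  leading form of every \<open>f\<close> divisible by \<open>X\<close>, and shifting \<open>X\<close> to \<open>Y\<close> repeatedly would kill it.\<close>
lemma exists_nonmultiple_of_X:
  assumes "vanish k S \<noteq> vanish (Suc k) S"
  shows "\<exists>r\<in>vanish (Suc (Suc k)) S.
    \<forall>f\<in>vanish (Suc k) S. \<forall>g\<in>vanish (Suc k) S. r \<noteq> pCons 0 f + g"
proof (rule ccontr)
  assume "\<not> ?thesis"
  then have all: "\<And>r. r \<in> vanish (Suc (Suc k)) S \<Longrightarrow>
      \<exists>f\<in>vanish (Suc k) S. \<exists>g\<in>vanish (Suc k) S. r = pCons 0 f + g"
    by blast
  \<comment> \<open>Compare the coefficients of \<open>s^i t^(k+2-i)\<close> in
    \<open>Y * f = X * h + g\<close>. The term \<open>g\<close> has too small a degree to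
    contribute, and \<open>X * h\<close> contributes a top-degree coefficient of \<open>h\<close>
    with exponent \<open>i - 1\<close> of \<open>s\<close>, which is zero by induction, or nothing
    at all if \<open>i = 0\<close>.\<close>
  have no: "f \<in> vanish (Suc k) S \<Longrightarrow> i \<le> Suc k \<Longrightarrow> coeff (coeff f i) (Suc k - i) = 0" for f i
  proof (induction i arbitrary: f rule: less_induct)
    case (less i)
    obtain h g where hg: "h \<in> vanish (Suc k) S" "g \<in> vanish (Suc k) S"
      and eq: "smult (pCons 0 [:1:]) f = pCons 0 h + g"
      using all[OF vanish_Y[OF less.prems(1)]] by blast
    have "coeff (coeff f i) (Suc k - i) = coeff (coeff (smult (pCons 0 [:1:]) f) i) (Suc (Suc k) - i)"
      using less.prems(2) by (simp add: Suc_diff_le)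
    also have "\<dots> = coeff (coeff (pCons 0 h) i) (Suc (Suc k) - i)"
      unfolding eq using hg(2) less.prems(2) by (simp add: vanish_def bivar_coeff_eq_0[of g "Suc k"])
    also have "\<dots> = 0"
    proof (cases i)
      case (Suc l)
      then show ?thesis using less.IH[of l h] hg(1) less.prems(2) by simp
    qed simp
    finally show ?case .
  qed
  have "vanish (Suc k) S \<subseteq> vanish k S"
  proof
    fix f assume f: "f \<in> vanish (Suc k) S"
    have "f \<in> bivar k"
    proof (rule bivarI)
      fix i j assume "k < i + j"
      then consider "Suc k < i + j" | "i \<le> Suc k" "j = Suc k - i" by linarith
      then show "coeff (coeff f i) j = 0"
        using f no by cases (auto simp: vanish_def bivar_coeff_eq_0)
    qed
    then show "f \<in> vanish k S" using f by (simp add: vanish_def)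
  qed
  then show False using assms vanish_mono[of k "Suc k" S] by auto
qed

text \<open>The multiplicative form of \<open>2 dim V(k+1) < dim V(k+2) + dim V(k)\<close>, where
  \<open>V(k)\<close> is \<open>vanish k S\<close>. The sum map from pairs \<open>(f, g)\<close> to
  \<open>X * f + g\<close> has fibres no larger than \<open>V(k)\<close>: two preimages differ in
  the first component by some \<open>f - w\<close> with \<open>X * (f - w)\<close> of degree at most
  \<open>k + 1\<close>. Its image \<open>M\<close> is a proper subset of
  \<open>V(k+2)\<close>.\<close>

lemma card_vanish_growth:
  fixes S :: "('a::{field,finite} \<times> 'a) set"
  assumes "vanish k S \<noteq> vanish (Suc k) S"
  shows "card (vanish (Suc k) S) ^ 2 < card (vanish (Suc (Suc k)) S) * card (vanish k S)"
proof -
  let ?V = "vanish (Suc k) S"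
  define M where "M = (\<lambda>(f, g). pCons 0 f + g) ` (?V \<times> ?V)"
  define w where "w = (\<lambda>r. SOME f. f \<in> ?V \<and> r - pCons 0 f \<in> ?V)"
  have w: "w (pCons 0 f + g) \<in> ?V \<and> pCons 0 f + g - pCons 0 (w (pCons 0 f + g)) \<in> ?V"
    if "f \<in> ?V" "g \<in> ?V" for f g
    unfolding w_def by (rule someI[of _ f]) (use that in auto)
  have "card (?V \<times> ?V) \<le> card (M \<times> vanish k S)"
  proof (rule card_inj_on_le)
    let ?F = "\<lambda>(f, g). (pCons 0 f + g, f - w (pCons 0 f + g))"
    show "inj_on ?F (?V \<times> ?V)" by (auto simp: inj_on_def)
    have "f - w (pCons 0 f + g) \<in> vanish k S" if fg: "f \<in> ?V" "g \<in> ?V" for f g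
    proof -
      let ?w = "w (pCons 0 f + g)"
      have "(pCons 0 f + g - pCons 0 ?w) - g \<in> ?V"
        using w[OF fg] fg(2) vanish_diff by blast
      moreover have "(pCons 0 f + g - pCons 0 ?w) - g = pCons 0 (f - ?w)"
        by simp
      ultimately have "pCons 0 (f - ?w) \<in> bivar (Suc k)" by (simp add: vanish_def)
      then have "f - ?w \<in> bivar k" by (rule bivar_X_cancel)
      moreover have "f - ?w \<in> ?V" using w[OF fg] fg(1) vanish_diff by blast
      ultimately show ?thesis by (simp add: vanish_def)
    qed
    then show "?F ` (?V \<times> ?V) \<subseteq> M \<times> vanish k S" by (auto simp: M_def)
    show "finite (M \<times> vanish k S)" by (simp add: M_def)
  qed
  then have "card ?V ^ 2 \<le> card M * card (vanish k S)"
    by (simp add: card_cartesian_product power2_eq_square)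
  moreover have "card M < card (vanish (Suc (Suc k)) S)"
  proof (rule psubset_card_mono)
    have "M \<subseteq> vanish (Suc (Suc k)) S"
      using vanish_mono[of "Suc k" "Suc (Suc k)" S] by (auto simp: M_def intro!: vanish_add vanish_X)
    moreover obtain r where "r \<in> vanish (Suc (Suc k)) S" "r \<notin> M"
      using exists_nonmultiple_of_X[OF assms] unfolding M_def by fast
    ultimately show "M \<subset> vanish (Suc (Suc k)) S" by blast
  qed simp
  moreover have "0 < card (vanish k S)" by (auto simp: card_gt_0_iff intro: vanish_zero)
  ultimately show ?thesis by (meson le_less_trans mult_less_mono1)
qed

text \<open>Macaulay's bound for the first difference, which can increase only as long as no form of
  degree \<open>k + 1\<close> is the leading form of a polynomial vanishing on \<open>S\<close>.\<close>
lemma hilbert_function_growth_bound: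
  fixes S :: "('a::{field,finite} \<times> 'a) set"
  assumes "finite S" and small: "hilbert_function S (Suc k) < hilbert_function S k + k + 2"
  shows "hilbert_function S (Suc (Suc k)) + hilbert_function S k \<le> 2 * hilbert_function S (Suc k)"
proof -
  let ?q = "card (UNIV :: 'a set)"
  let ?h = "hilbert_function S"
  let ?n = "\<lambda>k. triangle k - ?h k"
  have q: "1 < ?q" using card_field_ge_2[where 'a = 'a] by simp
  note le = hilbert_function_le_triangle[OF assms(1)]
  \<comment> \<open>From \<open>k\<close> to \<open>k + 1\<close> the polynomials gain
    \<open>k + 2\<close> dimensions but the rank gains fewer, so the vanishing space grows.\<close>
  have "?n k < ?n (Suc k)" using small le[of k] le[of "Suc k"] triangle_Suc[of k] by linarith
  then have "card (vanish k S) \<noteq> card (vanish (Suc k) S)"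
    unfolding card_vanish_eq_power[OF assms(1)] using q by simp
  then have "vanish k S \<noteq> vanish (Suc k) S" by metis
  from card_vanish_growth[OF this]
  have "?q ^ (?n (Suc k) * 2) < ?q ^ (?n (Suc (Suc k)) + ?n k)"
    unfolding card_vanish_eq_power[OF assms(1)] by (simp add: power_add power_mult)
  then have "?n (Suc k) * 2 < ?n (Suc (Suc k)) + ?n k" using q by simp
  \<comment> \<open>The second difference of \<open>triangle\<close> is 1, which absorbs the
    strictness of the inequality between the dimensions \<open>?n\<close>.\<close>
  then show ?thesis
    using le[of k] le[of "Suc k"] le[of "Suc (Suc k)"] triangle_Suc[of k] triangle_Suc[of "Suc k"]
    by linarith
qed

text \<open>The residual construction for ranks. Separators for points of \<open>C\<close> are
  multiples of \<open>f\<close>; a separator \<open>p\<close> for a point of \<open>B\<close> is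
  corrected by \<open>f\<close> times an interpolant of \<open>p / f\<close> on \<open>C\<close>,
  which leaves its values on \<open>B\<close> unchanged.\<close>

lemma independent_conditions_union:
  assumes B: "independent_conditions k B" and C: "independent_conditions l C"
    and f: "f \<in> bivar k" "\<forall>x\<in>B. ev2 f x = 0" "\<forall>x\<in>C. ev2 f x \<noteq> 0"
  shows "independent_conditions (k + l) (B \<union> C)"
  unfolding independent_conditions_def
proof (intro conjI ballI)
  show "finite (B \<union> C)" using B C by (simp add: independent_conditions_def)
next
  fix z assume z: "z \<in> B \<union> C"
  show "\<exists>p\<in>bivar (k + l). ev2 p z \<noteq> 0 \<and> (\<forall>x\<in>B \<union> C - {z}. ev2 p x = 0)"
  proof (cases "z \<in> C")
    case True
    then obtain q where "q \<in> bivar l" "ev2 q z \<noteq> 0" "\<forall>x\<in>C - {z}. ev2 q x = 0"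
      using C by (auto simp: independent_conditions_def)
    then show ?thesis
      using f True by (intro bexI[of _ "f * q"]) (auto intro: bivar_mult)
  next
    case False
    then obtain p where p: "p \<in> bivar k" "ev2 p z \<noteq> 0" "\<forall>x\<in>B - {z}. ev2 p x = 0"
      using B z by (auto simp: independent_conditions_def)
    obtain q where q: "q \<in> bivar l" "\<forall>x\<in>C. ev2 q x = ev2 p x / ev2 f x"
      using interpolation[OF C, of "\<lambda>x. ev2 p x / ev2 f x"] by blast
    have "p \<in> bivar (k + l)" using p(1) bivar_mono[of k "k + l"] by auto
    then have "p - f * q \<in> bivar (k + l)" using f(1) q(1) by (intro bivar_diff bivar_mult)
    then show ?thesis
      using f p q z False by (intro bexI[of _ "p - f * q"]) auto
  qed
qed

section \<open>Plane Cayley--Bacharach sets\<close>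

definition on_curve :: "'a::field poly poly \<Rightarrow> ('a \<times> 'a) set \<Rightarrow> ('a \<times> 'a) set" where
  "on_curve p S = {x \<in> S. ev2 p x = 0}"

definition off_curve :: "'a::field poly poly \<Rightarrow> ('a \<times> 'a) set \<Rightarrow> ('a \<times> 'a) set" where
  "off_curve p S = {x \<in> S. ev2 p x \<noteq> 0}"

lemma card_on_off:
  assumes "finite S"
  shows "card (on_curve p S) + card (off_curve p S) = card S"
proof -
  have "card (on_curve p S) + card (off_curve p S) = card (on_curve p S \<union> off_curve p S)"
    using assms by (intro card_Un_disjoint[symmetric]) (auto simp: on_curve_def off_curve_def)
  also have "on_curve p S \<union> off_curve p S = S" by (auto simp: on_curve_def off_curve_def)
  finally show ?thesis .
qed

lemma card_on_curve_mono:
  assumes "finite S" "T \<subseteq> S"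
  shows "card (on_curve p T) \<le> card (on_curve p S)"
  using assms by (intro card_mono) (auto simp: on_curve_def)

lemma on_curve_eq: "\<forall>x\<in>S. ev2 p x = 0 \<Longrightarrow> on_curve p S = S"
  by (auto simp: on_curve_def)

lemma card_le_on_curve:
  assumes "finite S" "T \<subseteq> S" "\<forall>x\<in>T. ev2 p x = 0"
  shows "card T \<le> card (on_curve p S)"
  using assms by (intro card_mono) (auto simp: on_curve_def)

lemma off_curve_subset: "off_curve p S \<subseteq> S"
  by (auto simp: off_curve_def)

abbreviation planar_cb :: "nat \<Rightarrow> ('a::{field,finite} \<times> 'a) set \<Rightarrow> bool" where
  "planar_cb \<equiv> bv.cayley_bacharach"

lemma planar_cb_off:
  assumes "planar_cb m S" "p \<in> bivar k" "k \<le> m"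
  shows "planar_cb (m - k) (off_curve p S)"
  using bv.cayley_bacharach_residual[OF assms(1) _ assms(3), of "ev2 p"] assms(2)
  by (simp add: off_curve_def)

text \<open>Linear polynomials form a space of dimension 3, so a nonzero one vanishes at
  \<open>a\<close> and \<open>b\<close>, hence on \<open>S\<close>. A nonzero element of
  \<open>bivar 1\<close> may be constant; it then vanishes nowhere, which is possible here only if
  \<open>a\<close> and \<open>b\<close> impose no zero at all, so never.\<close>

lemma on_line_planar:
  assumes "bv.on_line (S :: ('a::{field,finite} \<times> 'a) set)"
  shows "\<exists>l\<in>bivar 1. l \<noteq> 0 \<and> (\<forall>x\<in>S. ev2 l x = 0)"
proof -
  from assms obtain a b where
    ab: "\<forall>g\<in>ev2 ` bivar 1. g a = 0 \<longrightarrow> g b = 0 \<longrightarrow> (\<forall>x\<in>S. g x = 0)"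
    unfolding bv.on_line_def by blast
  have "card {a, b} < triangle 1"
    using card_length[of "[a, b]"] by (simp add: triangle_numerals[unfolded One_nat_def])
  then obtain l where "l \<in> bivar 1" "l \<noteq> 0" "\<forall>x\<in>{a, b}. ev2 l x = 0"
    using exists_vanishing[of "{a, b}" 1] by blast
  then show ?thesis using ab by (intro bexI[of _ l]) auto
qed

lemma planar_cb_line:
  assumes "planar_cb m S" "card S \<le> 2 * m + 1 \<or> card S \<le> m + 2"
  shows "\<exists>l\<in>bivar 1. l \<noteq> 0 \<and> (\<forall>x\<in>S. ev2 l x = 0)"
  using on_line_planar bv.cayley_bacharach_on_line[OF assms(1)]
    bv.cayley_bacharach_on_line'[OF assms(1)] assms(2) by blast

text \<open>Off a line, \<open>S\<close> has exactly \<open>2 * m + 2\<close> points. A conic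
  through five of them leaves at most \<open>2 * (m - 2) + 1\<close>; if any are left, they lie on a
  line \<open>l\<close> with at least \<open>m\<close> points. The residual of \<open>l\<close> then
  has at most \<open>m + 2\<close> points and lies on a second line, and the two lines form the
  conic.\<close>

lemma planar_conic:
  fixes S :: "('a::{field,finite} \<times> 'a) set"
  assumes cb: "planar_cb m S" and ne: "S \<noteq> {}" and card: "card S \<le> 2 * m + 2"
  shows "(\<exists>l\<in>bivar 1. l \<noteq> 0 \<and> m + 2 \<le> card (on_curve l S)) \<or>
    (card S = 2 * m + 2 \<and> (\<exists>Q\<in>bivar 2. Q \<noteq> 0 \<and> (\<forall>x\<in>S. ev2 Q x = 0)))"
proof (cases "\<exists>l\<in>bivar 1. l \<noteq> 0 \<and> (\<forall>x\<in>S. ev2 l x = 0)")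
  case True
  then obtain l where "l \<in> bivar 1" "l \<noteq> 0" "\<forall>x\<in>S. ev2 l x = 0" by blast
  moreover have "m + 2 \<le> card S" using bv.cayley_bacharach_card_ge[OF cb ne] .
  ultimately show ?thesis using on_curve_eq by metis
next
  case nl: False
  have fin: "finite S" using cb by (rule bv.cayley_bacharach_finite)
  have cS: "card S = 2 * m + 2" using planar_cb_line[OF cb] nl card by linarith
  have "\<exists>Q\<in>bivar 2. Q \<noteq> 0 \<and> (\<forall>x\<in>S. ev2 Q x = 0)"
  proof (cases "m \<le> 1")
    case True
    then show ?thesis using exists_vanishing[OF fin, of 2] cS by (simp add: triangle_numerals)
  next
    case False
    then obtain T where T: "T \<subseteq> S" "card T = 5"
      using obtain_subset_with_card_n[of 5 S] cS by auto
    then obtain Q where Q: "Q \<in> bivar 2" "Q \<noteq> 0" "\<forall>x\<in>T. ev2 Q x = 0"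
      using exists_vanishing[of T 2] finite_subset[OF T(1) fin] by (auto simp: triangle_numerals)
    show ?thesis
    proof (cases "off_curve Q S = {}")
      case True
      then show ?thesis using Q by (auto simp: off_curve_def)
    next
      case ne': False
      have cQ: "planar_cb (m - 2) (off_curve Q S)"
        using planar_cb_off[OF cb Q(1)] False by simp
      have "5 \<le> card (on_curve Q S)" using card_le_on_curve[OF fin T(1) Q(3)] T(2) by simp
      then have up: "card (off_curve Q S) \<le> 2 * m - 3"
        using card_on_off[OF fin, of Q] cS by linarith
      have lo: "m \<le> card (off_curve Q S)"
        using bv.cayley_bacharach_card_ge[OF cQ ne'] False by simp
      have m3: "3 \<le> m" using up lo False by linarith
      have "card (off_curve Q S) \<le> 2 * (m - 2) + 1" using up m3 by linarith
      then obtain l where l: "l \<in> bivar 1" "l \<noteq> 0" "\<forall>x\<in>off_curve Q S. ev2 l x = 0"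
        using planar_cb_line[OF cQ] by blast
      have "m \<le> card (on_curve l S)"
        using card_le_on_curve[OF fin off_curve_subset l(3)] lo by simp
      then have "card (off_curve l S) \<le> 2 * (m - 1) + 1"
        using card_on_off[OF fin, of l] cS m3 by linarith
      moreover have "planar_cb (m - 1) (off_curve l S)"
        using planar_cb_off[OF cb l(1)] m3 by simp
      ultimately obtain l' where l': "l' \<in> bivar 1" "l' \<noteq> 0" "\<forall>x\<in>off_curve l S. ev2 l' x = 0"
        using planar_cb_line by blast
      have "l * l' \<in> bivar 2" using bivar_mult[OF l(1) l'(1)] by (simp add: numeral_2_eq_2)
      then show ?thesis
        using l(2) l'(2,3) by (intro bexI[of _ "l * l'"]) (auto simp: off_curve_def)
    qed
  qed
  then show ?thesis using cS by blast
qed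

section \<open>Plane sets of at most \<open>3 * m\<close> points\<close>

definition no_three_collinear :: "('a::field \<times> 'a) set \<Rightarrow> bool" where
  "no_three_collinear S \<longleftrightarrow> (\<forall>l\<in>bivar 1. l \<noteq> 0 \<longrightarrow> card (on_curve l S) \<le> 2)"

lemma no_three_collinear_subset:
  assumes "no_three_collinear S" "finite S" "T \<subseteq> S"
  shows "no_three_collinear T"
  using assms card_on_curve_mono[OF assms(2,3)] unfolding no_three_collinear_def
  by (meson order_trans)

lemma planar_cb_card_no_three:
  assumes cb: "planar_cb m S" and ne: "S \<noteq> {}" and m: "1 \<le> m" and n3: "no_three_collinear S"
  shows "2 * m + 2 \<le> card S"
proof (rule ccontr)
  assume "\<not> ?thesis"
  then obtain l where l: "l \<in> bivar 1" "l \<noteq> 0" "\<forall>x\<in>S. ev2 l x = 0"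
    using planar_cb_line[OF cb] by auto
  have "card S \<le> 2" using n3 l on_curve_eq[OF l(3)] by (auto simp: no_three_collinear_def)
  then show False using bv.cayley_bacharach_card_ge[OF cb ne] m by simp
qed

text \<open>The first two alternatives only bound the points on the curve from below, so that they
  pass from a residual to the whole set; the cubic alternative fixes the cardinality.\<close>

definition planar_alternatives :: "nat \<Rightarrow> ('a::field \<times> 'a) set \<Rightarrow> bool" where
  "planar_alternatives m S \<longleftrightarrow>
     (\<exists>l\<in>bivar 1. l \<noteq> 0 \<and> m + 2 \<le> card (on_curve l S)) \<or>
     (\<exists>Q\<in>bivar 2. Q \<noteq> 0 \<and> 2 * m + 2 \<le> card (on_curve Q S)) \<or>
     (card S = 3 * m \<and> (\<exists>Q\<in>bivar 3. Q \<noteq> 0 \<and> (\<forall>x\<in>S. ev2 Q x = 0)))"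

lemma planar_alternatives_small:
  assumes "planar_cb m S" "S \<noteq> {}" "card S \<le> 2 * m + 2"
  shows "planar_alternatives m S"
  using planar_conic[OF assms] on_curve_eq unfolding planar_alternatives_def
  by (metis order_refl)

text \<open>A set of nine points satisfying the Cayley--Bacharach condition for cubics imposes at most
  eight conditions on cubics, which leaves room for one further point.\<close>
lemma nine_points_cubic:
  fixes T :: "('a::{field,finite} \<times> 'a) set"
  assumes cb: "planar_cb 3 T" and card: "card T = 9"
  shows "\<exists>Q\<in>bivar 3. Q \<noteq> 0 \<and> (\<forall>x\<in>insert y T. ev2 Q x = 0)"
proof -
  have fin: "finite T" using cb by (rule bv.cayley_bacharach_finite)
  obtain z where z: "z \<in> T" using card by (metis all_not_in_conv card.empty zero_neq_numeral)
  have "card (insert y (T - {z})) < triangle 3"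
    using card_insert_le_m1[of 9 "T - {z}" y] fin z card by (simp add: triangle_numerals)
  then obtain Q where Q: "Q \<in> bivar 3" "Q \<noteq> 0" "\<forall>x\<in>insert y (T - {z}). ev2 Q x = 0"
    using exists_vanishing[of "insert y (T - {z})" 3] fin by blast
  \<comment> \<open>The residual in degree 0 is contained in \<open>{z}\<close>. A single point
    carries no nontrivial relation, so \<open>Q\<close> vanishes at \<open>z\<close> too.\<close>
  have "planar_cb 0 (off_curve Q T)" using planar_cb_off[OF cb Q(1)] by simp
  moreover have "card (off_curve Q T) \<le> card {z}"
    using Q(3) by (intro card_mono) (auto simp: off_curve_def)
  ultimately have "off_curve Q T = {}"
    using bv.cayley_bacharach_card_ge_2[of 0 "off_curve Q T"] by force
  then show ?thesis using Q by (intro bexI[of _ Q]) (auto simp: off_curve_def)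
qed

text \<open>The inductive step by contradiction: lines and conics with many points are excluded, and
  it remains to find \<open>card S = 3 * m\<close> and a cubic through \<open>S\<close>.\<close>

locale planar_step =
  fixes m :: nat and S :: "('a::{field,finite} \<times> 'a) set"
  assumes IH: "\<And>k T. k < m \<Longrightarrow> planar_cb k T \<Longrightarrow> T \<noteq> {} \<Longrightarrow> card T \<le> 3 * k \<Longrightarrow>
      planar_alternatives k (T :: ('a \<times> 'a) set)"
    and m3: "3 \<le> m" and cb: "planar_cb m S" and ne: "S \<noteq> {}" and card_le: "card S \<le> 3 * m"
    and no_line: "\<And>l. l \<in> bivar 1 \<Longrightarrow> l \<noteq> 0 \<Longrightarrow> card (on_curve l S) < m + 2"
    and no_conic: "\<And>Q. Q \<in> bivar 2 \<Longrightarrow> Q \<noteq> 0 \<Longrightarrow> card (on_curve Q S) < 2 * m + 2"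
begin

lemma fin: "finite S"
  using cb by (rule bv.cayley_bacharach_finite)

lemma card_ge: "2 * m + 3 \<le> card S"
proof (rule ccontr)
  assume "\<not> ?thesis"
  then have "(\<exists>l\<in>bivar 1. l \<noteq> 0 \<and> m + 2 \<le> card (on_curve l S)) \<or>
    (card S = 2 * m + 2 \<and> (\<exists>Q\<in>bivar 2. Q \<noteq> 0 \<and> (\<forall>x\<in>S. ev2 Q x = 0)))"
    by (intro planar_conic[OF cb ne]) simp
  then show False
  proof (elim disjE conjE bexE)
    fix l assume "l \<in> bivar 1" "l \<noteq> 0" "m + 2 \<le> card (on_curve l S)"
    then show False using no_line[of l] by simp
  next
    fix Q assume "card S = 2 * m + 2" "Q \<in> bivar 2" "Q \<noteq> 0" "\<forall>x\<in>S. ev2 Q x = 0"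
    then show False using no_conic[of Q] on_curve_eq[of S Q] by simp
  qed
qed

lemma off_conic_nonempty:
  assumes "Q \<in> bivar 2" "Q \<noteq> 0"
  shows "off_curve Q S \<noteq> {}"
  using no_conic[OF assms] card_ge card_on_off[OF fin, of Q] by auto

lemma off_conic_cb:
  assumes "Q \<in> bivar 2"
  shows "planar_cb (m - 2) (off_curve Q S)"
  using planar_cb_off[OF cb assms] m3 by simp

text \<open>A smaller residual would, by induction, have too many points on a line or at least
  \<open>2 * m - 2\<close> points on a conic \<open>C\<close>. But the residual of \<open>C\<close>
  also has at least \<open>2 * m - 2\<close> points, and \<open>4 * m - 4\<close> exceeds
  \<open>3 * m\<close> for \<open>m \<ge> 5\<close>.\<close>

lemma off_conic_large:
  assumes n3: "no_three_collinear S" and Q: "Q \<in> bivar 2" "Q \<noteq> 0"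
  shows "3 * (m - 2) \<le> card (off_curve Q S)"
proof (rule ccontr)
  let ?T = "off_curve Q S"
  assume small: "\<not> ?thesis"
  have n3T: "no_three_collinear (off_curve p S)" for p
    using n3 fin off_curve_subset by (rule no_three_collinear_subset)
  have "2 * (m - 2) + 2 \<le> card ?T"
    using planar_cb_card_no_three[OF off_conic_cb off_conic_nonempty _ n3T] Q m3 by simp
  then have m5: "5 \<le> m" using small by linarith
  have "planar_alternatives (m - 2) ?T"
    using IH[of "m - 2" ?T] off_conic_cb off_conic_nonempty Q small m3 by simp
  then consider (line) l where "l \<in> bivar 1" "l \<noteq> 0" "m - 2 + 2 \<le> card (on_curve l ?T)"
    | (conic) C where "C \<in> bivar 2" "C \<noteq> 0" "2 * (m - 2) + 2 \<le> card (on_curve C ?T)"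
    using small unfolding planar_alternatives_def by auto
  then show False
  proof cases
    case line
    then show False using n3T[of Q] m3 unfolding no_three_collinear_def by force
  next
    case conic
    have "2 * (m - 2) + 2 \<le> card (on_curve C S)"
      using conic(3) card_on_curve_mono[OF fin off_curve_subset, of C Q] by simp
    moreover have "2 * (m - 2) + 2 \<le> card (off_curve C S)"
      using planar_cb_card_no_three[OF off_conic_cb off_conic_nonempty _ n3T] conic(1,2) m3 by simp
    ultimately show False using card_on_off[OF fin, of C] card_le m5 by linarith
  qed
qed

text \<open>If \<open>S\<close> lies on no cubic, the residual of a cubic through nine points falls
  under the induction hypothesis. A line is excluded; a conic carries at most six points of
  \<open>S\<close> by \<open>off_conic_large\<close>, which forces \<open>m = 5\<close>; a cubic
  \<open>C\<close> through the residual leaves at most nine points of \<open>S\<close>, which forces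
  \<open>m \<le> 6\<close>.\<close>

lemma off_cubic_card:
  assumes n3: "no_three_collinear S" and Q: "Q \<in> bivar 3" and nine: "9 \<le> card (on_curve Q S)"
    and nc: "\<And>C. C \<in> bivar 3 \<Longrightarrow> C \<noteq> 0 \<Longrightarrow> off_curve C S \<noteq> {}" and Q0: "Q \<noteq> 0"
  shows "card (off_curve Q S) = 3 * m - 9 \<and> (m = 5 \<or> m = 6)"
proof -
  have n3T: "no_three_collinear (off_curve p S)" for p
    using n3 fin off_curve_subset by (rule no_three_collinear_subset)
  let ?T = "off_curve Q S"
  have up: "card ?T \<le> 3 * m - 9" using nine card_le card_on_off[OF fin, of Q] by linarith
  have cbT: "planar_cb (m - 3) (off_curve C S)" if "C \<in> bivar 3" for C
    using planar_cb_off[OF cb that] m3 by simp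
  have "m \<noteq> 3"
  proof
    assume "m = 3"
    then have "card ?T = 0" using up by simp
    then show False using nc[OF Q Q0] fin off_curve_subset[of Q S] finite_subset by fastforce
  qed
  then have m4: "4 \<le> m" using m3 by simp
  have lo: "2 * (m - 3) + 2 \<le> card (off_curve C S)" if "C \<in> bivar 3" "C \<noteq> 0" for C
    using planar_cb_card_no_three[OF cbT nc _ n3T] that m4 by simp
  have m5: "5 \<le> m" using lo[OF Q Q0] up m4 by linarith
  have "planar_alternatives (m - 3) ?T"
    using IH[of "m - 3" ?T] cbT[OF Q] nc[OF Q Q0] up m3 by simp
  then consider (line) l where "l \<in> bivar 1" "l \<noteq> 0" "m - 3 + 2 \<le> card (on_curve l ?T)"
    | (conic) C where "C \<in> bivar 2" "C \<noteq> 0" "2 * (m - 3) + 2 \<le> card (on_curve C ?T)"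
    | (cubic) C where "C \<in> bivar 3" "C \<noteq> 0" "card ?T = 3 * (m - 3)" "\<forall>x\<in>?T. ev2 C x = 0"
    unfolding planar_alternatives_def by blast
  then show ?thesis
  proof cases
    case line
    then have False using n3T[of Q] m5 unfolding no_three_collinear_def by force
    then show ?thesis ..
  next
    case conic
    have "2 * (m - 3) + 2 \<le> card (on_curve C S)"
      using conic(3) card_on_curve_mono[OF fin off_curve_subset, of C Q] by simp
    moreover have "card (on_curve C S) \<le> 6"
      using off_conic_large[OF n3 conic(1,2)] card_on_off[OF fin, of C] card_le m3 by linarith
    ultimately have "m = 5" using m5 by linarith
    then show ?thesis using lo[OF Q Q0] up by simp
  next
    case cubic
    have "card ?T \<le> card (on_curve C S)"
      using card_le_on_curve[OF fin off_curve_subset cubic(4)] .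
    then have "card (off_curve C S) \<le> 9"
      using cubic(3) card_on_off[OF fin, of C] card_le m3 by linarith
    then have "m \<le> 6" using lo[OF cubic(1,2)] m5 by linarith
    then show ?thesis using m5 cubic(3) by auto
  qed
qed

text \<open>For the two remaining values of \<open>m\<close>, a nine-point residual \<open>U\<close>
  satisfying the condition in degree 3 is found. A cubic through \<open>U\<close> can be made to
  pass through a tenth point of \<open>S\<close>, contradicting the exact count of
  \<open>off_cubic_card\<close>.\<close>

lemma cubic_exists:
  assumes n3: "no_three_collinear S"
  shows "\<exists>Q\<in>bivar 3. Q \<noteq> 0 \<and> (\<forall>x\<in>S. ev2 Q x = 0)"
proof (rule ccontr)
  assume "\<not> ?thesis"
  then have nc: "\<And>C. C \<in> bivar 3 \<Longrightarrow> C \<noteq> 0 \<Longrightarrow> off_curve C S \<noteq> {}"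
    by (force simp: off_curve_def)
  obtain T where T: "T \<subseteq> S" "card T = 9"
    using obtain_subset_with_card_n[of 9 S] card_ge m3 by auto
  then obtain Q where Q: "Q \<in> bivar 3" "Q \<noteq> 0" "\<forall>x\<in>T. ev2 Q x = 0"
    using exists_vanishing[of T 3] finite_subset[OF T(1) fin] by (auto simp: triangle_numerals)
  have "9 \<le> card (on_curve Q S)" using card_le_on_curve[OF fin T(1) Q(3)] T(2) by simp
  then have cT: "card (off_curve Q S) = 3 * m - 9" and m56: "m = 5 \<or> m = 6"
    using off_cubic_card[OF n3 Q(1) _ nc Q(2)] by auto
  have "\<exists>U\<subseteq>S. planar_cb 3 U \<and> card U = 9"
  proof (cases "m = 6")
    case True
    then show ?thesis
      using planar_cb_off[OF cb Q(1)] cT off_curve_subset by (intro exI[of _ "off_curve Q S"]) auto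
  next
    case False
    then have m5: "m = 5" using m56 by simp
    have cb2: "planar_cb 2 (off_curve Q S)" using planar_cb_off[OF cb Q(1)] m5 by simp
    have n3T: "no_three_collinear (off_curve Q S)"
      using n3 fin off_curve_subset by (rule no_three_collinear_subset)
    \<comment> \<open>Six is \<open>2 * 2 + 2\<close>, so \<open>planar_conic\<close> in degree 2
      puts these points on a conic, whose own residual has exactly \<open>15 - 6\<close>
      points.\<close>
    have "card (off_curve Q S) = 6" using cT m5 by simp
    then obtain C where C: "C \<in> bivar 2" "C \<noteq> 0" "\<forall>x\<in>off_curve Q S. ev2 C x = 0"
      using planar_conic[OF cb2 nc[OF Q(1,2)]] n3T unfolding no_three_collinear_def by force
    have "6 \<le> card (on_curve C S)"
      using card_le_on_curve[OF fin off_curve_subset C(3)] cT m5 by simp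
    moreover have "9 \<le> card (off_curve C S)" using off_conic_large[OF n3 C(1,2)] m5 by simp
    ultimately have "card (off_curve C S) = 9" using card_on_off[OF fin, of C] card_le m5 by linarith
    then show ?thesis
      using off_conic_cb[OF C(1)] m5 off_curve_subset by (intro exI[of _ "off_curve C S"]) auto
  qed
  then obtain U where U: "U \<subseteq> S" "planar_cb 3 U" "card U = 9" by blast
  have "U \<noteq> S" using U(3) card_ge m56 by auto
  then obtain y where y: "y \<in> S" "y \<notin> U" using U(1) by blast
  obtain R where R: "R \<in> bivar 3" "R \<noteq> 0" "\<forall>x\<in>insert y U. ev2 R x = 0"
    using nine_points_cubic[OF U(2,3)] by blast
  have "card (insert y U) = 10" using U y finite_subset[OF U(1) fin] by simp
  then have ten: "10 \<le> card (on_curve R S)"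
    using card_le_on_curve[OF fin _ R(3)] U(1) y(1) by simp
  then have "card (off_curve R S) = 3 * m - 9" using off_cubic_card[OF n3 R(1) _ nc R(2)] by simp
  then show False using ten card_on_off[OF fin, of R] card_le m3 by linarith
qed

text \<open>Take an independent \<open>B\<close> of maximal rank in degree \<open>b\<close> and a
  separator \<open>f\<close> of one of its points. The residual of \<open>f\<close> contains six
  points independent for conics; adding them to \<open>B - {y}\<close> gains six and loses
  one.\<close>

lemma hilbert_function_step:
  assumes n3: "no_three_collinear S" and lt: "card S < 3 * m" and b: "b + 2 \<le> m"
  shows "hilbert_function S b + 5 \<le> hilbert_function S (b + 2)"
proof -
  obtain B where B: "B \<subseteq> S" "independent_conditions b B" "vanish b B = vanish b S"
    "card B = hilbert_function S b"
    using hilbert_function_witness[OF fin] by blast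
  have "B \<noteq> {}"
  proof
    assume "B = {}"
    then have "1 \<in> vanish b S" using B(3) by (auto simp: vanish_def)
    then show False using ne by (auto simp: vanish_def)
  qed
  then obtain y where y: "y \<in> B" by blast
  then obtain f where f: "f \<in> bivar b" "ev2 f y \<noteq> 0" "\<forall>x\<in>B - {y}. ev2 f x = 0"
    using B(2) by (auto simp: independent_conditions_def)
  let ?T = "off_curve f S"
  have finT: "finite ?T" using fin off_curve_subset finite_subset by blast
  have cbT: "planar_cb (m - b) ?T" using planar_cb_off[OF cb f(1)] b by simp
  have "y \<in> ?T" using f(2) y B(1) by (auto simp: off_curve_def)
  then have neT: "?T \<noteq> {}" by blast
  have "no_three_collinear ?T" using n3 fin off_curve_subset by (rule no_three_collinear_subset)
  then have "2 * (m - b) + 2 \<le> card ?T" using planar_cb_card_no_three[OF cbT neT] b by simp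
  then have T6: "6 \<le> card ?T" using b by linarith
  \<comment> \<open>A conic containing the residual would have at least six points of
    \<open>S\<close> on it and \<open>3 * (m - 2)\<close> off it, too many when
    \<open>card S < 3 * m\<close>.\<close>
  have "\<exists>x\<in>?T. ev2 Q x \<noteq> 0" if Q: "Q \<in> bivar 2" "Q \<noteq> 0" for Q
  proof (rule ccontr)
    assume "\<not> ?thesis"
    then have "6 \<le> card (on_curve Q S)"
      using card_le_on_curve[OF fin off_curve_subset, of f Q] T6 by force
    then show False
      using off_conic_large[OF n3 Q] card_on_off[OF fin, of Q] lt m3 by linarith
  qed
  then have "hilbert_function ?T 2 = 6"
    using hilbert_function_eq_triangle[OF finT, of 2] by (simp add: triangle_numerals)
  then obtain C where C: "C \<subseteq> ?T" "independent_conditions 2 C" "card C = 6"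
    using hilbert_function_witness[OF finT, of 2] by metis
  have finB: "finite B" using B(1) fin finite_subset by blast
  have "independent_conditions b (B - {y})"
    using B(2) unfolding independent_conditions_def by blast
  then have "independent_conditions (b + 2) ((B - {y}) \<union> C)"
    using C f by (intro independent_conditions_union[where f = f]) (auto simp: off_curve_def)
  then have "card ((B - {y}) \<union> C) \<le> hilbert_function S (b + 2)"
    using B(1) C(1) off_curve_subset[of f S]
    by (intro independent_card_le_hilbert_function[OF fin]) auto
  moreover have "card ((B - {y}) \<union> C) = card (B - {y}) + card C"
    using finB finite_subset[OF C(1) finT] C(1) f(3)
    by (intro card_Un_disjoint) (auto simp: off_curve_def)
  moreover have "card (B - {y}) = card B - 1" "0 < card B"
    using finB y by (auto simp: card_gt_0_iff)
  ultimately show ?thesis using B(4) C(3) by linarith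
qed

text \<open>If some first difference were at most 2, the next one would be too by Macaulay's bound,
  and two consecutive steps would gain at most 4 instead of 5.\<close>

lemma hilbert_function_lower:
  assumes n3: "no_three_collinear S" and lt: "card S < 3 * m"
  shows "1 \<le> k \<Longrightarrow> k < m \<Longrightarrow> 3 * k \<le> hilbert_function S k"
proof (induction k)
  case (Suc k)
  show ?case
  proof (cases "k = 0")
    case True
    have "\<exists>x\<in>S. ev2 l x \<noteq> 0" if "l \<in> bivar 1" "l \<noteq> 0" for l
      using no_line[OF that] on_curve_eq[of S l] card_ge by force
    then show ?thesis
      using hilbert_function_eq_triangle[OF fin, of 1] True by (simp add: triangle_numerals[unfolded One_nat_def])
  next
    case False
    have "hilbert_function S k + 3 \<le> hilbert_function S (Suc k)"
    proof (rule ccontr)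
      assume "\<not> ?thesis"
      then have small: "hilbert_function S (Suc k) \<le> hilbert_function S k + 2" by simp
      then have "hilbert_function S (Suc (Suc k)) + hilbert_function S k
          \<le> 2 * hilbert_function S (Suc k)"
        using False by (intro hilbert_function_growth_bound[OF fin]) simp
      moreover have "hilbert_function S k + 5 \<le> hilbert_function S (Suc (Suc k))"
        using hilbert_function_step[OF n3 lt, of k] Suc.prems by simp
      ultimately show False using small by linarith
    qed
    then show ?thesis using Suc False by simp
  qed
qed simp

text \<open>In degree \<open>m - 1\<close> the separator of a point in a maximal independent subset
  vanishes at \<open>3 * m - 4\<close> or more points of \<open>S\<close>. If
  \<open>card S < 3 * m\<close>, at most three remain, but a nonempty residual in degree 1 without
  three collinear points needs four.\<close>

lemma card_eq:
  assumes n3: "no_three_collinear S"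
  shows "card S = 3 * m"
proof (rule ccontr)
  assume "card S \<noteq> 3 * m"
  then have lt: "card S < 3 * m" using card_le by simp
  have h: "3 * (m - 1) \<le> hilbert_function S (m - 1)"
    using hilbert_function_lower[OF n3 lt, of "m - 1"] m3 by simp
  obtain B where B: "B \<subseteq> S" "independent_conditions (m - 1) B"
    "card B = hilbert_function S (m - 1)"
    using hilbert_function_witness[OF fin, of "m - 1"] by metis
  then have "B \<noteq> {}" using h m3 by auto
  then obtain y where y: "y \<in> B" by blast
  then obtain f where f: "f \<in> bivar (m - 1)" "ev2 f y \<noteq> 0" "\<forall>x\<in>B - {y}. ev2 f x = 0"
    using B(2) by (auto simp: independent_conditions_def)
  let ?T = "off_curve f S"
  have cbT: "planar_cb 1 ?T" using planar_cb_off[OF cb f(1)] m3 by simp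
  have "y \<in> ?T" using f(2) y B(1) by (auto simp: off_curve_def)
  then have neT: "?T \<noteq> {}" by blast
  have "no_three_collinear ?T" using n3 fin off_curve_subset by (rule no_three_collinear_subset)
  then have "4 \<le> card ?T" using planar_cb_card_no_three[OF cbT neT] by simp
  moreover have "card B - 1 \<le> card (on_curve f S)"
    using card_le_on_curve[OF fin _ f(3)] B(1) y finite_subset[OF B(1) fin] by auto
  ultimately show False using card_on_off[OF fin, of f] lt h B(3) m3 by linarith
qed

text \<open>Induction is applied to the residual of a line with the greatest number of points of
  \<open>S\<close>; as this number is at least 3, the residual has at most
  \<open>3 * (m - 1)\<close> points.\<close>

lemma three_collinear_case:
  assumes "\<not> no_three_collinear S"
  shows "card S = 3 * m \<and> (\<exists>Q\<in>bivar 3. Q \<noteq> 0 \<and> (\<forall>x\<in>S. ev2 Q x = 0))"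
proof -
  let ?L = "\<lambda>l. l \<in> bivar 1 \<and> l \<noteq> 0"
  let ?n = "\<lambda>l. card (on_curve l S)"
  obtain l0 where l0: "?L l0" "3 \<le> ?n l0"
    using assms by (force simp: no_three_collinear_def)
  have "\<forall>l. ?L l \<longrightarrow> ?n l < m + 2" using no_line by blast
  with l0(1) have "\<exists>l. ?L l \<and> (\<forall>l'. ?L l' \<longrightarrow> ?n l' \<le> ?n l)" by (rule ex_has_greatest_nat)
  then obtain l where l: "l \<in> bivar 1" "l \<noteq> 0" and max: "\<And>l'. ?L l' \<Longrightarrow> ?n l' \<le> ?n l" by blast
  have n3: "3 \<le> ?n l" using max[OF l0(1)] l0(2) by simp
  let ?T = "off_curve l S"
  have cT: "?n l + card ?T = card S" using card_on_off[OF fin] .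
  have neT: "?T \<noteq> {}"
  proof
    assume "?T = {}"
    then have "?n l = card S" using cT by simp
    then show False using no_line[OF l] card_ge by simp
  qed
  have cbT: "planar_cb (m - 1) ?T" using planar_cb_off[OF cb l(1)] m3 by simp
  have finT: "finite ?T" using cbT by (rule bv.cayley_bacharach_finite)
  have "planar_alternatives (m - 1) ?T"
    using IH[OF _ cbT neT] cT n3 card_le m3 by simp
  then consider (line) l' where "l' \<in> bivar 1" "l' \<noteq> 0" "m - 1 + 2 \<le> card (on_curve l' ?T)"
    | (conic) C where "C \<in> bivar 2" "C \<noteq> 0" "2 * (m - 1) + 2 \<le> card (on_curve C ?T)"
    | (cubic) C where "C \<in> bivar 3" "C \<noteq> 0" "card ?T = 3 * (m - 1)" "\<forall>x\<in>?T. ev2 C x = 0"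
    unfolding planar_alternatives_def by blast
  then show ?thesis
  proof cases
    case line
    \<comment> \<open>By maximality \<open>l\<close> also has at least \<open>m + 1\<close> points,
      so the rest lies on a line \<open>k\<close>, and the conic \<open>l * k\<close> would contain
      all of \<open>S\<close>.\<close>
    have "m + 1 \<le> ?n l'"
      using line(3) card_on_curve_mono[OF fin off_curve_subset, of l' l] m3 by linarith
    then have "card ?T \<le> 2 * (m - 1) + 1" using max[of l'] line(1,2) cT card_le m3 by linarith
    then obtain k where k: "k \<in> bivar 1" "k \<noteq> 0" "\<forall>x\<in>?T. ev2 k x = 0"
      using planar_cb_line[OF cbT] by blast
    have lk: "l * k \<in> bivar 2" using bivar_mult[OF l(1) k(1)] by (simp add: numeral_2_eq_2)
    have "on_curve (l * k) S = S" using k(3) by (auto simp: on_curve_def off_curve_def)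
    then have False using no_conic[OF lk] l(2) k(2) card_ge by simp
    then show ?thesis ..
  next
    case conic
    \<comment> \<open>The residual of \<open>C\<close> has at most \<open>m\<close> points, hence
      exactly \<open>m\<close>, the least number in degree \<open>m - 2\<close>; so it is collinear
      and completes \<open>C\<close> to a cubic.\<close>
    have on: "2 * m \<le> card (on_curve C S)"
      using conic(3) card_on_curve_mono[OF fin off_curve_subset, of C l] m3 by linarith
    then have off: "card (off_curve C S) \<le> m" using card_on_off[OF fin, of C] card_le by linarith
    have "m - 2 + 2 \<le> card (off_curve C S)"
      using bv.cayley_bacharach_card_ge[OF off_conic_cb off_conic_nonempty] conic(1,2) by blast
    then have "card S = 3 * m" using on off card_on_off[OF fin, of C] card_le m3 by linarith
    moreover have "card (off_curve C S) \<le> m - 2 + 2" using off m3 by linarith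
    then obtain k where k: "k \<in> bivar 1" "k \<noteq> 0" "\<forall>x\<in>off_curve C S. ev2 k x = 0"
      using planar_cb_line[OF off_conic_cb[OF conic(1)]] by blast
    moreover have "C * k \<in> bivar 3" using bivar_mult[OF conic(1) k(1)] by (simp add: numeral_3_eq_3)
    moreover have "\<forall>x\<in>S. ev2 (C * k) x = 0" using k(3) by (auto simp: off_curve_def)
    moreover have "C * k \<noteq> 0" using conic(2) k(2) by simp
    ultimately show ?thesis by blast
  next
    case cubic
    have cS: "card S = 3 * m" and l3: "?n l = 3" using cubic(3) cT n3 card_le m3 by linarith+
    have "\<exists>Q\<in>bivar 3. Q \<noteq> 0 \<and> (\<forall>x\<in>S. ev2 Q x = 0)"
    proof (cases "off_curve C S = {}")
      case True
      then show ?thesis using cubic(1,2) by (auto simp: off_curve_def)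
    next
      case False
      \<comment> \<open>Points missed by \<open>C\<close> are among the three on \<open>l\<close>,
        while a nonempty residual in degree \<open>m - 3\<close> needs \<open>m - 1\<close> points.
        Only \<open>m = 3\<close> and \<open>m = 4\<close> survive.\<close>
      have "card (off_curve C S) \<le> ?n l"
        using cubic(4) fin by (intro card_mono) (auto simp: on_curve_def off_curve_def)
      moreover have "planar_cb (m - 3) (off_curve C S)"
        using planar_cb_off[OF cb cubic(1)] m3 by simp
      ultimately have "m - 3 + 2 \<le> 3"
        using bv.cayley_bacharach_card_ge[OF _ False, of "m - 3"] l3 by linarith
      then have "m = 3 \<or> m = 4" using m3 by linarith
      then show ?thesis
      proof
        assume "m = 3"
        then show ?thesis using exists_vanishing[OF fin, of 3] cS by (simp add: triangle_numerals)
      next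
        assume m4: "m = 4"
        have "on_curve l S \<noteq> {}" using n3 by auto
        then obtain y where y: "y \<in> on_curve l S" by blast
        \<comment> \<open>For \<open>m = 4\<close> the nine points off \<open>l\<close> satisfy the
          condition in degree 3, so some cubic contains them and \<open>y\<close>. It misses at most
          two points, fewer than a nonempty residual in degree 1 requires.\<close>
        obtain Q where Q: "Q \<in> bivar 3" "Q \<noteq> 0" "\<forall>x\<in>insert y ?T. ev2 Q x = 0"
          using nine_points_cubic[of ?T y] cbT cubic(3) m4 by auto
        have "off_curve Q S = {}"
        proof (rule ccontr)
          assume neQ: "off_curve Q S \<noteq> {}"
          have "planar_cb 1 (off_curve Q S)" using planar_cb_off[OF cb Q(1)] m4 by simp
          then have "3 \<le> card (off_curve Q S)"
            using bv.cayley_bacharach_card_ge[OF _ neQ, of 1] by simp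
          also have "\<dots> \<le> card (on_curve l S - {y})"
            using Q(3) fin by (intro card_mono) (auto simp: on_curve_def off_curve_def)
          also have "\<dots> = 2" using y l3 by simp
          finally show False by simp
        qed
        then show ?thesis using Q(1,2) by (auto simp: off_curve_def)
      qed
    qed
    then show ?thesis using cS by blast
  qed
qed

end

lemma planar_main:
  assumes "planar_cb m S" "S \<noteq> {}" "card S \<le> 3 * m"
  shows "planar_alternatives m S"
  using assms
proof (induction m arbitrary: S rule: less_induct)
  case (less m)
  show ?case
  proof (cases "m \<le> 2")
    \<comment> \<open>Here \<open>3 * m \<le> 2 * m + 2\<close>, so the conic statement
      suffices.\<close>
    case True
    then show ?thesis using less.prems by (intro planar_alternatives_small) auto
  next
    case False
    show ?thesis
    proof (rule ccontr)
      assume contra: "\<not> ?thesis"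
      interpret planar_step m S
        using less False contra unfolding planar_alternatives_def[of m S]
        by unfold_locales (auto simp: not_le)
      have "card S = 3 * m \<and> (\<exists>Q\<in>bivar 3. Q \<noteq> 0 \<and> (\<forall>x\<in>S. ev2 Q x = 0))"
        using three_collinear_case card_eq cubic_exists by blast
      then show False using contra unfolding planar_alternatives_def by blast
    qed
  qed
qed

section \<open>Polynomial functions, lines and planes in affine space\<close>

text \<open>Functions rather than coefficient families: over a finite field distinct polynomials may
  define the same function, and only values at points matter here.\<close>

definition polyfun :: "nat \<Rightarrow> (('r::finite \<Rightarrow> 'a::field) \<Rightarrow> 'a) set" where
  "polyfun k = range (mpoly_eval k)"

lemma finite_monomials: "finite (monomials k :: ('r::finite \<Rightarrow> nat) set)"
proof (rule finite_subset)
  show "monomials k \<subseteq> (UNIV :: 'r set) \<rightarrow>\<^sub>E {..k}"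
  proof
    fix \<alpha> :: "'r \<Rightarrow> nat" assume "\<alpha> \<in> monomials k"
    then have "\<alpha> j \<le> k" for j
      using member_le_sum[of j UNIV \<alpha>] by (simp add: monomials_def)
    then show "\<alpha> \<in> UNIV \<rightarrow>\<^sub>E {..k}" by auto
  qed
  show "finite ((UNIV :: 'r set) \<rightarrow>\<^sub>E {..k})" by (intro finite_PiE) auto
qed

lemma polyfun_monomial:
  fixes \<alpha> :: "'r::finite \<Rightarrow> nat" and c :: "'a::field"
  assumes "\<alpha> \<in> monomials k"
  shows "(\<lambda>x. c * (\<Prod>j\<in>UNIV. x j ^ \<alpha> j)) \<in> polyfun k"
proof -
  have "mpoly_eval k (\<lambda>\<beta>. if \<beta> = \<alpha> then c else 0) x = c * (\<Prod>j\<in>UNIV. x j ^ \<alpha> j)" for x :: "'r \<Rightarrow> 'a"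
  proof -
    have "mpoly_eval k (\<lambda>\<beta>. if \<beta> = \<alpha> then c else 0) x
        = (\<Sum>\<beta>\<in>monomials k. if \<beta> = \<alpha> then c * (\<Prod>j\<in>UNIV. x j ^ \<alpha> j) else 0)"
      unfolding mpoly_eval_def by (intro sum.cong) auto
    then show ?thesis using assms by (simp add: finite_monomials)
  qed
  then show ?thesis unfolding polyfun_def by (metis (no_types, lifting) ext rangeI)
qed

lemma polyfun_const: "(\<lambda>_. c) \<in> polyfun k"
  using polyfun_monomial[of "\<lambda>_. 0" k c] by (simp add: monomials_def)

lemma polyfun_coord: "(\<lambda>x :: 'r::finite \<Rightarrow> 'a::field. x j) \<in> polyfun 1"
proof -
  let ?\<alpha> = "\<lambda>i. if i = j then 1 else 0 :: nat"
  have "?\<alpha> \<in> monomials 1" by (simp add: monomials_def)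
  moreover have "(\<Prod>i\<in>UNIV. x i ^ ?\<alpha> i) = x j" for x :: "'r \<Rightarrow> 'a"
  proof -
    have "(\<Prod>i\<in>UNIV. x i ^ ?\<alpha> i) = (\<Prod>i\<in>UNIV. if i = j then x j else 1)"
      by (intro prod.cong) auto
    then show ?thesis by simp
  qed
  ultimately show ?thesis using polyfun_monomial[of ?\<alpha> 1 "1 :: 'a"] by (simp only: mult_1_left)
qed

lemma polyfun_add:
  assumes "f \<in> polyfun k" "g \<in> polyfun k"
  shows "(\<lambda>x. f x + g x) \<in> polyfun k"
proof -
  from assms obtain a b where ab: "f = mpoly_eval k a" "g = mpoly_eval k b"
    by (auto simp: polyfun_def)
  have "(\<lambda>x. f x + g x) = mpoly_eval k (\<lambda>\<alpha>. a \<alpha> + b \<alpha>)"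
    by (rule ext) (simp add: ab mpoly_eval_def sum.distrib algebra_simps)
  then show ?thesis by (simp add: polyfun_def)
qed

lemma polyfun_mult:
  assumes "f \<in> polyfun k" "g \<in> polyfun l"
  shows "(\<lambda>x. f x * g x) \<in> polyfun (k + l)"
proof -
  from assms obtain a b where ab: "f = mpoly_eval k a" "g = mpoly_eval l b"
    by (auto simp: polyfun_def)
  let ?P = "monomials k \<times> monomials l :: (('a \<Rightarrow> nat) \<times> ('a \<Rightarrow> nat)) set"
  let ?s = "\<lambda>z :: ('a \<Rightarrow> nat) \<times> ('a \<Rightarrow> nat). (\<lambda>j. fst z j + snd z j)"
  define c where "c \<gamma> = (\<Sum>z\<in>{z. z \<in> ?P \<and> ?s z = \<gamma>}. a (fst z) * b (snd z))" for \<gamma>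
  have "f x * g x = mpoly_eval (k + l) c x" for x
  proof -
    let ?m = "\<lambda>\<alpha>. \<Prod>j\<in>UNIV. x j ^ \<alpha> j"
    have "f x * g x = (\<Sum>\<alpha>\<in>monomials k. \<Sum>\<beta>\<in>monomials l. (a \<alpha> * ?m \<alpha>) * (b \<beta> * ?m \<beta>))"
      by (simp add: ab mpoly_eval_def sum_product)
    also have "\<dots> = (\<Sum>z\<in>?P. (a (fst z) * ?m (fst z)) * (b (snd z) * ?m (snd z)))"
      by (simp add: sum.cartesian_product case_prod_beta)
    also have "\<dots> = (\<Sum>z\<in>?P. a (fst z) * b (snd z) * ?m (?s z))"
      by (simp add: power_add prod.distrib mult_ac)
    also have "\<dots> = (\<Sum>\<gamma>\<in>monomials (k + l). \<Sum>z\<in>{z. z \<in> ?P \<and> ?s z = \<gamma>}.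
        a (fst z) * b (snd z) * ?m (?s z))"
    proof (rule sum.group[symmetric])
      show "?s ` ?P \<subseteq> monomials (k + l)" by (auto simp: monomials_def sum.distrib)
    qed (auto simp: finite_monomials)
    also have "\<dots> = (\<Sum>\<gamma>\<in>monomials (k + l). c \<gamma> * ?m \<gamma>)"
      unfolding c_def sum_distrib_right by (intro sum.cong refl) auto
    finally show ?thesis by (simp add: mpoly_eval_def)
  qed
  then have "(\<lambda>x. f x * g x) = mpoly_eval (k + l) c" by (intro ext)
  then show ?thesis by (simp add: polyfun_def)
qed

lemma polyfun_cmult: "f \<in> polyfun k \<Longrightarrow> (\<lambda>x. c * f x) \<in> polyfun k"
  using polyfun_mult[OF polyfun_const[of c 0]] by fastforce

lemma polyfun_diff:
  assumes "f \<in> polyfun k" "g \<in> polyfun k"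
  shows "(\<lambda>x. f x - g x) \<in> polyfun k"
  using polyfun_add[OF assms(1) polyfun_cmult[OF assms(2), of "- 1"]] by simp

lemma polyfun_mono:
  assumes "f \<in> polyfun k" "k \<le> l"
  shows "f \<in> polyfun l"
  using polyfun_mult[OF assms(1) polyfun_const[of 1 "l - k"]] assms(2) by simp

lemma polyfun_sum: "(\<And>i. i \<in> A \<Longrightarrow> f i \<in> polyfun k) \<Longrightarrow> (\<lambda>x. \<Sum>i\<in>A. f i x) \<in> polyfun k"
  by (induction A rule: infinite_finite_induct) (auto intro: polyfun_const polyfun_add)

lemma polyfun_power: "f \<in> polyfun 1 \<Longrightarrow> (\<lambda>x. f x ^ i) \<in> polyfun i"
proof (induction i)
  case (Suc i)
  then show ?case using polyfun_mult[of f 1 "\<lambda>x. f x ^ i" i] by simp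
qed (simp add: polyfun_const)

text \<open>Pulls plane polynomials back to affine space without raising the degree, so that the
  plane results apply to coplanar sets.\<close>

lemma polyfun_bivar:
  assumes "p \<in> bivar k" "\<sigma> \<in> polyfun 1" "\<tau> \<in> polyfun 1"
  shows "(\<lambda>x. ev2 p (\<sigma> x, \<tau> x)) \<in> polyfun k"
  unfolding ev2_eq_sum[OF assms(1)]
proof (intro polyfun_sum)
  fix i j
  show "(\<lambda>x. coeff (coeff p i) j * \<sigma> x ^ i * \<tau> x ^ j) \<in> polyfun k"
  proof (cases "i + j \<le> k")
    case True
    have "(\<lambda>x. \<sigma> x ^ i * \<tau> x ^ j) \<in> polyfun k"
      using polyfun_mono[OF polyfun_mult[OF polyfun_power polyfun_power] True] assms(2,3) .
    from polyfun_cmult[OF this] show ?thesis by (simp add: mult.assoc)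
  next
    case False
    then show ?thesis using assms(1) by (simp add: bivar_coeff_eq_0 polyfun_const)
  qed
qed

interpretation pf: graded_functions "polyfun :: nat \<Rightarrow> (('r::finite \<Rightarrow> 'a::field) \<Rightarrow> 'a) set"
proof
  fix x y :: "'r \<Rightarrow> 'a"
  assume "x \<noteq> y"
  then obtain j where "x j \<noteq> y j" by blast
  moreover have "(\<lambda>z. z j - x j) \<in> polyfun 1"
    by (rule polyfun_diff[OF polyfun_coord polyfun_const])
  ultimately show "\<exists>f\<in>polyfun 1. f x = 0 \<and> f y \<noteq> 0"
    by (intro bexI[of _ "\<lambda>z. z j - x j"]) auto
qed (auto intro: polyfun_const polyfun_mult)

section \<open>Collinear sets and degree 1 functions\<close>

lemma polyfun_on_line:
  assumes "f \<in> polyfun k"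
  shows "\<exists>q. degree q \<le> k \<and> (\<forall>t. f (\<lambda>j. p j + t * v j) = poly q t)"
proof -
  from assms obtain a where a: "f = mpoly_eval k a" by (auto simp: polyfun_def)
  define q where "q = (\<Sum>\<alpha>\<in>monomials k. smult (a \<alpha>) (\<Prod>j\<in>UNIV. [:p j, v j:] ^ \<alpha> j))"
  have "degree q \<le> k"
    unfolding q_def
  proof (intro degree_sum_le finite_monomials)
    fix \<alpha> :: "'a \<Rightarrow> nat" assume \<alpha>: "\<alpha> \<in> monomials k"
    have "degree (smult (a \<alpha>) (\<Prod>j\<in>UNIV. [:p j, v j:] ^ \<alpha> j))
        \<le> degree (\<Prod>j\<in>UNIV. [:p j, v j:] ^ \<alpha> j)" by (rule degree_smult_le)
    also have "\<dots> \<le> (\<Sum>j\<in>UNIV. degree ([:p j, v j:] ^ \<alpha> j))"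
      using degree_prod_sum_le[of UNIV "\<lambda>j. [:p j, v j:] ^ \<alpha> j"] by (simp add: o_def)
    also have "\<dots> \<le> (\<Sum>j\<in>UNIV. \<alpha> j)"
    proof (rule sum_mono)
      fix j
      have "degree ([:p j, v j:] ^ \<alpha> j) \<le> degree [:p j, v j:] * \<alpha> j" by (rule degree_power_le)
      also have "\<dots> \<le> 1 * \<alpha> j" by (intro mult_le_mono1) simp
      finally show "degree ([:p j, v j:] ^ \<alpha> j) \<le> \<alpha> j" by simp
    qed
    also have "\<dots> \<le> k" using \<alpha> by (simp add: monomials_def)
    finally show "degree (smult (a \<alpha>) (\<Prod>j\<in>UNIV. [:p j, v j:] ^ \<alpha> j)) \<le> k" .
  qed
  moreover have "f (\<lambda>j. p j + t * v j) = poly q t" for t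
    by (simp add: a q_def mpoly_eval_def poly_sum poly_prod poly_power)
  ultimately show ?thesis by blast
qed

text \<open>Along the parametrised line \<open>f\<close> becomes a univariate polynomial of degree
  at most 1, and two distinct roots make it zero.\<close>

lemma linear_vanishes_on_collinear:
  assumes f: "f \<in> polyfun 1" and S: "collinear_pts S"
    and ab: "a \<in> S" "b \<in> S" "a \<noteq> b" "f a = 0" "f b = 0" and x: "x \<in> S"
  shows "f x = 0"
proof -
  obtain p v where pv: "\<forall>x\<in>S. \<exists>t. \<forall>j. x j = p j + t * v j"
    using S by (auto simp: collinear_pts_def)
  then have pv': "\<exists>t. x = (\<lambda>j. p j + t * v j)" if "x \<in> S" for x using that by (metis ext)
  obtain q where q: "degree q \<le> 1" "\<And>t. f (\<lambda>j. p j + t * v j) = poly q t"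
    using polyfun_on_line[OF f] by blast
  obtain s t r where s: "a = (\<lambda>j. p j + s * v j)" and t: "b = (\<lambda>j. p j + t * v j)"
    and r: "x = (\<lambda>j. p j + r * v j)"
    using pv'[OF ab(1)] pv'[OF ab(2)] pv'[OF x] by blast
  have "q = 0"
  proof (rule ccontr)
    assume q0: "q \<noteq> 0"
    have "s \<noteq> t" using s t ab(3) by auto
    then have "2 = card {s, t}" by simp
    also have "\<dots> \<le> card {x. poly q x = 0}"
      using q(2)[of s] q(2)[of t] s t ab(4,5)
      by (intro card_mono poly_roots_finite q0) auto
    also have "\<dots> \<le> degree q" by (rule card_poly_roots_bound[OF q0])
    finally show False using q(1) by simp
  qed
  then show ?thesis using q(2)[of r] r by simp
qed

lemma on_line_imp_collinear:
  assumes "pf.on_line S"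
  shows "collinear_pts S"
proof -
  obtain a b where ab: "\<And>g x. g \<in> polyfun 1 \<Longrightarrow> g a = 0 \<Longrightarrow> g b = 0 \<Longrightarrow> x \<in> S \<Longrightarrow> g x = 0"
    using assms unfolding pf.on_line_def by blast
  show ?thesis
  proof (cases "a = b")
    case True
    \<comment> \<open>If \<open>a = b\<close>, the functions \<open>z j - a j\<close> show that
      every point of \<open>S\<close> equals \<open>a\<close>; the direction vector is then
      zero.\<close>
    have key: "x j = a j + 0 * 0" if "x \<in> S" for x j
      using ab[OF polyfun_diff[OF polyfun_coord polyfun_const[of "a j"]] _ _ that, of j] True by simp
    show ?thesis unfolding collinear_pts_def
      by (rule exI[of _ a], rule exI[of _ "\<lambda>_. 0"], intro ballI exI allI, rule key)
  next
    case False
    then obtain i where i: "a i \<noteq> b i" by blast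
    have key: "x j = a j + ((x i - a i) / (b i - a i)) * (b j - a j)" if "x \<in> S" for x j
    proof -
      \<comment> \<open>This function vanishes at \<open>a\<close> and \<open>b\<close>, hence on
        \<open>S\<close>, which yields the parameter \<open>(x i - a i) / (b i - a i)\<close> on the
        line through them.\<close>
      let ?g = "\<lambda>z. (z j - a j) - ((b j - a j) / (b i - a i)) * (z i - a i)"
      have g: "?g \<in> polyfun 1"
        by (intro polyfun_diff polyfun_cmult polyfun_coord polyfun_const)
      have "?g x = 0" using ab[of ?g, OF g _ _ that] i by simp
      then have "x j = a j + ((b j - a j) / (b i - a i)) * (x i - a i)"
        by (simp only: diff_diff_eq right_minus_eq)
      also have "((b j - a j) / (b i - a i)) * (x i - a i)
          = ((x i - a i) / (b i - a i)) * (b j - a j)" by simp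
      finally show ?thesis .
    qed
    show ?thesis unfolding collinear_pts_def
      by (rule exI[of _ a], rule exI[of _ "\<lambda>j. b j - a j"], intro ballI exI allI, rule key)
  qed
qed

section \<open>Planes, their coordinates and hyperplanes containing them\<close>

definition plane :: "('r \<Rightarrow> 'a::field) \<Rightarrow> ('r \<Rightarrow> 'a) \<Rightarrow> ('r \<Rightarrow> 'a) \<Rightarrow> ('r \<Rightarrow> 'a) set" where
  "plane p u w = {x. \<exists>s t. in_plane_at p u w x s t}"

definition coplanar :: "('r \<Rightarrow> 'a::field) set \<Rightarrow> bool" where
  "coplanar S \<longleftrightarrow> (\<exists>p u w. lin_indep2 u w \<and> S \<subseteq> plane p u w)"

lemma coplanar_subset: "coplanar S \<Longrightarrow> T \<subseteq> S \<Longrightarrow> coplanar T"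
  unfolding coplanar_def by blast

lemma on_plane_curve_coplanar: "on_plane_curve k S \<Longrightarrow> coplanar S"
  unfolding on_plane_curve_def coplanar_def plane_def by blast

lemma lin_indep2_minor:
  assumes "lin_indep2 u w"
  shows "\<exists>i j. u i * w j - u j * w i \<noteq> 0"
proof (rule ccontr)
  assume "\<not> ?thesis"
  then have z: "u i * w j - u j * w i = 0" for i j by blast
  obtain j where j: "w j \<noteq> 0"
    using assms[unfolded lin_indep2_def, rule_format, of 0 1] by auto
  have "\<forall>i. w j * u i + (- u j) * w i = 0" using z[of _ j] by (simp add: algebra_simps)
  then show False using assms j unfolding lin_indep2_def by blast
qed

text \<open>Cramer's rule for a nonvanishing minor of \<open>u\<close> and \<open>w\<close> gives
  coordinates defined on the whole space. The plane is cut out by the equations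
  \<open>x l = p l + \<sigma> x * u l + \<tau> x * w l\<close>, and one of them fails at any point
  outside.\<close>

lemma plane_coordinates:
  assumes "lin_indep2 u w"
  shows "\<exists>\<sigma>\<in>polyfun 1. \<exists>\<tau>\<in>polyfun 1.
    (\<forall>x s t. in_plane_at p u w x s t \<longrightarrow> \<sigma> x = s \<and> \<tau> x = t) \<and>
    (\<forall>x. x \<notin> plane p u w \<longrightarrow> (\<exists>g\<in>polyfun 1. (\<forall>y\<in>plane p u w. g y = 0) \<and> g x \<noteq> 0))"
proof -
  obtain i j where D: "u i * w j - u j * w i \<noteq> 0" using lin_indep2_minor[OF assms] by blast
  define d where "d = inverse (u i * w j - u j * w i)"
  have d: "d * (u i * w j - u j * w i) = 1" using D by (simp add: d_def)
  define \<sigma> where "\<sigma> = (\<lambda>x. (d * w j) * (x i - p i) - (d * w i) * (x j - p j))"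
  define \<tau> where "\<tau> = (\<lambda>x. (d * u i) * (x j - p j) - (d * u j) * (x i - p i))"
  have pf: "\<sigma> \<in> polyfun 1" "\<tau> \<in> polyfun 1"
    unfolding \<sigma>_def \<tau>_def by (intro polyfun_diff polyfun_cmult polyfun_coord polyfun_const)+
  have co: "\<sigma> x = s \<and> \<tau> x = t" if "in_plane_at p u w x s t" for x s t
  proof -
    have x: "x l = p l + s * u l + t * w l" for l using that by (simp add: in_plane_at_def)
    have "\<sigma> x = s * (d * (u i * w j - u j * w i))" by (simp add: \<sigma>_def x algebra_simps)
    moreover have "\<tau> x = t * (d * (u i * w j - u j * w i))" by (simp add: \<tau>_def x algebra_simps)
    ultimately show ?thesis by (simp add: d)
  qed
  have "\<exists>g\<in>polyfun 1. (\<forall>y\<in>plane p u w. g y = 0) \<and> g x \<noteq> 0" if x: "x \<notin> plane p u w" for x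
  proof -
    obtain l where l: "x l \<noteq> p l + \<sigma> x * u l + \<tau> x * w l"
      using x unfolding plane_def in_plane_at_def by blast
    let ?g = "\<lambda>y. ((y l - p l) - u l * \<sigma> y) - w l * \<tau> y"
    have "?g \<in> polyfun 1"
      by (intro polyfun_diff polyfun_cmult polyfun_coord polyfun_const pf)
    moreover have "?g y = 0" if y: "y \<in> plane p u w" for y
    proof -
      obtain s t where st: "in_plane_at p u w y s t" using y by (auto simp: plane_def)
      then have "y l = p l + s * u l + t * w l" by (simp add: in_plane_at_def)
      then show ?thesis using co[OF st] by simp
    qed
    moreover have "?g x \<noteq> 0" using l by (auto simp: algebra_simps)
    ultimately show ?thesis by (intro bexI[of _ ?g] conjI ballI)
  qed
  then show ?thesis using pf co by (intro bexI[of _ \<sigma>] bexI[of _ \<tau>]) simp_all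
qed

lemma separating_hyperplane:
  assumes "coplanar T" "\<not> coplanar S"
  shows "\<exists>f\<in>polyfun 1. (\<forall>y\<in>T. f y = 0) \<and> (\<exists>z\<in>S. f z \<noteq> 0)"
proof -
  obtain p u w where T: "lin_indep2 u w" "T \<subseteq> plane p u w"
    using assms(1) by (auto simp: coplanar_def)
  then obtain z where "z \<in> S" "z \<notin> plane p u w" using assms(2) unfolding coplanar_def by blast
  moreover from this obtain g where "g \<in> polyfun 1" "\<forall>y\<in>plane p u w. g y = 0" "g z \<noteq> 0"
    using plane_coordinates[OF T(1), of p] by blast
  ultimately show ?thesis using T(2) by blast
qed

lemma lin_indep2_extend:
  fixes e :: "'r::finite \<Rightarrow> 'a::field"
  assumes "2 \<le> card (UNIV :: 'r set)" "e i \<noteq> 0"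
  shows "\<exists>w. lin_indep2 e w"
proof -
  obtain j where j: "j \<noteq> i" using two_elements[OF assms(1)] by metis
  have "lin_indep2 e (\<lambda>l. if l = j then 1 else 0)"
    unfolding lin_indep2_def
  proof (intro allI impI)
    fix a b :: 'a assume z: "\<forall>l. a * e l + b * (if l = j then 1 else 0) = 0"
    have "a = 0" using z[rule_format, of i] j assms(2) by simp
    then show "a = 0 \<and> b = 0" using z[rule_format, of j] by simp
  qed
  then show ?thesis by blast
qed

text \<open>The plane is spanned by the direction \<open>v\<close> of the line and
  \<open>y = x - p\<close>. If these are dependent, both are multiples of one nonzero vector, which
  extends to a plane because there are at least two coordinates.\<close>

lemma coplanar_insert_collinear:
  fixes A :: "('r::finite \<Rightarrow> 'a::field) set"
  assumes r2: "2 \<le> card (UNIV :: 'r set)" and A: "collinear_pts A"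
  shows "coplanar (insert x A)"
proof -
  obtain p v where pv: "\<forall>y\<in>A. \<exists>t. \<forall>j. y j = p j + t * v j"
    using A by (auto simp: collinear_pts_def)
  define y where "y = (\<lambda>j. x j - p j)"
  have line: "coplanar (insert x A)"
    if e: "e i \<noteq> 0" and v: "\<And>j. v j = \<alpha> * e j" and y: "\<And>j. y j = \<beta> * e j" for e i \<alpha> \<beta>
  proof -
    obtain w where w: "lin_indep2 e w" using lin_indep2_extend[of e i] r2 e by blast
    have "in_plane_at p e w x \<beta> 0"
      using y by (simp add: in_plane_at_def y_def algebra_simps)
    moreover have "\<exists>s. in_plane_at p e w z s 0" if z: "z \<in> A" for z
    proof -
      obtain t where "\<forall>j. z j = p j + t * v j" using pv z by blast
      then show ?thesis using v by (intro exI[of _ "t * \<alpha>"]) (simp add: in_plane_at_def)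
    qed
    ultimately have "insert x A \<subseteq> plane p e w" unfolding plane_def by blast
    then show ?thesis using w by (auto simp: coplanar_def)
  qed
  show ?thesis
  proof (cases "lin_indep2 v y")
    case True
    have "in_plane_at p v y x 0 1" by (simp add: in_plane_at_def y_def)
    moreover have "\<exists>s. in_plane_at p v y z s 0" if "z \<in> A" for z
      using pv that by (simp add: in_plane_at_def)
    ultimately have "insert x A \<subseteq> plane p v y" unfolding plane_def by blast
    then show ?thesis using True by (auto simp: coplanar_def)
  next
    case False
    then obtain a b where ab: "\<And>j. a * v j + b * y j = 0" "a \<noteq> 0 \<or> b \<noteq> 0"
      unfolding lin_indep2_def by blast
    consider (y) i where "y i \<noteq> 0" | (v) i where "v i \<noteq> 0" "\<And>j. y j = 0"
      | (none) "\<And>j. y j = 0" "\<And>j. v j = 0" by blast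
    then show ?thesis
    proof cases
      case (y i)
      then have "a \<noteq> 0" using ab(1)[of i] ab(2) by auto
      then have "v j = (a * v j + b * y j) / a + (- b / a) * y j" for j
        by (simp add: add_divide_distrib)
      then have "v j = (- b / a) * y j" for j
        unfolding ab(1) by simp
      then show ?thesis using line[of y i "- b / a" 1] y by simp
    next
      case (v i)
      then show ?thesis using line[of v i 1 0] by simp
    next
      case none
      \<comment> \<open>All points equal \<open>p\<close>, so any nonzero vector will do; the
        constant 1 is nonzero at every index, including \<open>undefined\<close>.\<close>
      then show ?thesis using line[of "\<lambda>_. 1" undefined 0 0] by simp
    qed
  qed
qed

lemma collinear_pair: "collinear_pts {a, b}"
  unfolding collinear_pts_def
proof (rule exI[of _ a], rule exI[of _ "\<lambda>j. b j - a j"], rule ballI)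
  fix x assume "x \<in> {a, b}"
  then have "(\<forall>j. x j = a j + 0 * (b j - a j)) \<or> (\<forall>j. x j = a j + 1 * (b j - a j))" by auto
  then show "\<exists>t. \<forall>j. x j = a j + t * (b j - a j)" by blast
qed

lemma coplanar_card_le_3:
  fixes T :: "('r::finite \<Rightarrow> 'a::field) set"
  assumes r2: "2 \<le> card (UNIV :: 'r set)" and T: "finite T" "card T \<le> 3"
  shows "coplanar T"
proof -
  have "\<exists>x y z. T \<subseteq> insert x {y, z}"
  proof (cases "T = {}")
    case False
    then obtain x where x: "x \<in> T" by blast
    then have "card (T - {x}) \<le> 2" using T by simp
    then consider "card (T - {x}) = 0" | "card (T - {x}) = 1" | "card (T - {x}) = 2" by linarith
    then obtain y z where "T - {x} \<subseteq> {y, z}"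
      using T(1) by cases (auto simp: card_1_singleton_iff card_2_iff)
    then show ?thesis by blast
  qed auto
  then obtain x y z where "T \<subseteq> insert x {y, z}" by blast
  then show ?thesis
    using coplanar_subset coplanar_insert_collinear[OF r2 collinear_pair] by blast
qed

section \<open>Cayley--Bacharach sets in affine space\<close>

definition chart :: "(('r \<Rightarrow> 'a) \<Rightarrow> 'a) \<Rightarrow> (('r \<Rightarrow> 'a) \<Rightarrow> 'a) \<Rightarrow> ('r \<Rightarrow> 'a) \<Rightarrow> 'a \<times> 'a" where
  "chart \<sigma> \<tau> x = (\<sigma> x, \<tau> x)"

text \<open>The coordinates are functions on all of affine space; only on the plane are they
  required to be the plane parameters.\<close>

locale plane_chart =
  fixes p u w :: "'r::finite \<Rightarrow> 'a::{field,finite}" and \<sigma> \<tau> :: "('r \<Rightarrow> 'a) \<Rightarrow> 'a"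
  assumes indep: "lin_indep2 u w"
    and polyfun: "\<sigma> \<in> polyfun 1" "\<tau> \<in> polyfun 1"
    and coords: "in_plane_at p u w x s t \<Longrightarrow> \<sigma> x = s \<and> \<tau> x = t"
begin

lemma in_plane_chart:
  assumes "x \<in> plane p u w"
  shows "in_plane_at p u w x (\<sigma> x) (\<tau> x)"
proof -
  obtain s t where "in_plane_at p u w x s t" using assms by (auto simp: plane_def)
  then show ?thesis using coords by blast
qed

lemma inj_on_chart:
  assumes "S \<subseteq> plane p u w"
  shows "inj_on (chart \<sigma> \<tau>) S"
proof (rule inj_onI)
  fix x y assume xy: "x \<in> S" "y \<in> S" and eq: "chart \<sigma> \<tau> x = chart \<sigma> \<tau> y"
  have "in_plane_at p u w x (\<sigma> x) (\<tau> x)" "in_plane_at p u w y (\<sigma> y) (\<tau> y)"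
    using xy assms by (auto intro: in_plane_chart)
  then show "x = y" using eq by (intro ext) (simp add: in_plane_at_def chart_def)
qed

lemma polyfun_chart: "q \<in> bivar k \<Longrightarrow> (\<lambda>x. ev2 q (chart \<sigma> \<tau> x)) \<in> polyfun k"
  unfolding chart_def using polyfun by (intro polyfun_bivar)

text \<open>The chart is injective on the plane, so the weights are carried over to the image, and
  test polynomials pull back with the same degree bound.\<close>

lemma planar_cb_chart:
  assumes cb: "pf.cayley_bacharach m S" and S: "S \<subseteq> plane p u w"
  shows "planar_cb m (chart \<sigma> \<tau> ` S)"
proof -
  let ?\<phi> = "chart \<sigma> \<tau>"
  note inj = inj_on_chart[OF S]
  obtain c where fin: "finite S" and c: "\<forall>x\<in>S. c x \<noteq> 0"
    and z: "\<And>f. f \<in> polyfun m \<Longrightarrow> (\<Sum>x\<in>S. c x * f x) = 0"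
    using cb unfolding pf.cayley_bacharach_def by blast
  have "(\<Sum>y\<in>?\<phi> ` S. c (inv_into S ?\<phi> y) * ev2 q y) = 0" if "q \<in> bivar m" for q
    using z[OF polyfun_chart[OF that]] by (simp add: sum.reindex[OF inj] inv_into_f_f[OF inj])
  moreover have "\<forall>y\<in>?\<phi> ` S. c (inv_into S ?\<phi> y) \<noteq> 0" using c by (simp add: inv_into_f_f[OF inj])
  ultimately show ?thesis
    unfolding bv.cayley_bacharach_def using fin
    by (intro conjI exI[of _ "\<lambda>y. c (inv_into S ?\<phi> y)"]) auto
qed

lemma on_plane_curve_chart:
  assumes "S \<subseteq> plane p u w" "q \<in> bivar k" "q \<noteq> 0" "\<forall>x\<in>S. ev2 q (chart \<sigma> \<tau> x) = 0"
  shows "on_plane_curve k S"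
proof -
  have "\<exists>s t. in_plane_at p u w x s t \<and> bpoly_eval k (\<lambda>i j. coeff (coeff q i) j) s t = 0"
    if "x \<in> S" for x
    using in_plane_chart[of x] assms that
    by (intro exI[of _ "\<sigma> x"] exI[of _ "\<tau> x"]) (auto simp: ev2_eq_bpoly_eval chart_def)
  then show ?thesis
    unfolding on_plane_curve_def using indep bpoly_nonzero_coeff[OF assms(2,3)] by blast
qed

lemma collinear_chart:
  assumes S: "S \<subseteq> plane p u w" and l: "l \<in> bivar 1" "l \<noteq> 0" "\<forall>x\<in>S. ev2 l (chart \<sigma> \<tau> x) = 0"
  shows "collinear_pts S"
proof -
  define a b c where "a = coeff (coeff l 0) 0" and "b = coeff (coeff l 1) 0" and "c = coeff (coeff l 0) 1"
  have l11: "coeff (coeff l 1) 1 = 0" using l(1) by (simp add: bivar_coeff_eq_0)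
  have "{..1} = {0, 1 :: nat}" by auto
  then have ev: "ev2 l (s, t) = a + b * s + c * t" for s t
    using l11 by (simp add: ev2_eq_sum[OF l(1)] a_def b_def c_def)
  have x: "x j = p j + \<sigma> x * u j + \<tau> x * w j" if "x \<in> S" for x j
    using in_plane_chart[of x] that S by (auto simp: in_plane_at_def)
  have eq: "a + b * \<sigma> x + c * \<tau> x = 0" if "x \<in> S" for x
    using l(3) that by (simp add: chart_def ev)
  consider (b) "b \<noteq> 0" | (c) "c \<noteq> 0" | (0) "b = 0" "c = 0" by blast
  then show ?thesis
  proof cases
    case b
    have key: "x j = (p j - a / b * u j) + \<tau> x * (w j - c / b * u j)" if "x \<in> S" for x j
    proof -
      have "\<sigma> x = (a + b * \<sigma> x + c * \<tau> x) / b - a / b - c / b * \<tau> x"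
        using b by (simp add: add_divide_distrib)
      then have "\<sigma> x = - (a / b) - c / b * \<tau> x" by (simp add: eq[OF that])
      with x[OF that, of j] have "x j = p j + (- (a / b) - c / b * \<tau> x) * u j + \<tau> x * w j"
        by (simp only:)
      also have "\<dots> = (p j - a / b * u j) + \<tau> x * (w j - c / b * u j)"
        by (simp add: algebra_simps)
      finally show ?thesis .
    qed
    show ?thesis unfolding collinear_pts_def
      by (rule exI[of _ "\<lambda>j. p j - a / b * u j"], rule exI[of _ "\<lambda>j. w j - c / b * u j"],
        intro ballI exI allI, rule key)
  next
    case c
    have key: "x j = (p j - a / c * w j) + \<sigma> x * (u j - b / c * w j)" if "x \<in> S" for x j
    proof -
      have "\<tau> x = (a + b * \<sigma> x + c * \<tau> x) / c - a / c - b / c * \<sigma> x"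
        using c by (simp add: add_divide_distrib)
      then have "\<tau> x = - (a / c) - b / c * \<sigma> x" by (simp add: eq[OF that])
      with x[OF that, of j] have "x j = p j + \<sigma> x * u j + (- (a / c) - b / c * \<sigma> x) * w j"
        by (simp only:)
      also have "\<dots> = (p j - a / c * w j) + \<sigma> x * (u j - b / c * w j)"
        by (simp add: algebra_simps)
      finally show ?thesis .
    qed
    show ?thesis unfolding collinear_pts_def
      by (rule exI[of _ "\<lambda>j. p j - a / c * w j"], rule exI[of _ "\<lambda>j. u j - b / c * w j"],
        intro ballI exI allI, rule key)
  next
    case 0
    \<comment> \<open>Now \<open>l\<close> is a nonzero constant, which vanishes nowhere, so
      \<open>S\<close> is empty.\<close>
    have "a \<noteq> 0"
    proof
      assume "a = 0"
      have "coeff (coeff l i) j = 0" for i j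
      proof (cases "i + j \<le> 1")
        case True
        then consider "i = 0 \<and> j = 0" | "i = 1 \<and> j = 0" | "i = 0 \<and> j = 1" by linarith
        then show ?thesis using 0 \<open>a = 0\<close> by cases (simp_all add: a_def b_def c_def)
      next
        case False
        then show ?thesis using l(1) by (simp add: bivar_coeff_eq_0)
      qed
      then have "l = 0" by (intro poly_eqI) simp
      then show False using l(2) by simp
    qed
    then have "S = {}" using eq 0 by auto
    then show ?thesis by (simp add: collinear_pts_def)
  qed
qed

text \<open>Two points of \<open>A\<close>, or its only point taken twice, control vanishing on all
  of \<open>A\<close>, and three coefficients exceed two conditions.\<close>

lemma line_of_collinear:
  assumes A: "collinear_pts A"
  shows "\<exists>l\<in>bivar 1. l \<noteq> 0 \<and> (\<forall>x\<in>A. ev2 l (chart \<sigma> \<tau> x) = 0)"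
proof -
  have "\<exists>a b. \<forall>l\<in>bivar 1. ev2 l (chart \<sigma> \<tau> a) = 0 \<longrightarrow> ev2 l (chart \<sigma> \<tau> b) = 0 \<longrightarrow>
      (\<forall>x\<in>A. ev2 l (chart \<sigma> \<tau> x) = 0)"
  proof (cases "\<exists>a\<in>A. \<exists>b\<in>A. a \<noteq> b")
    case True
    then obtain a b where ab: "a \<in> A" "b \<in> A" "a \<noteq> b" by blast
    have "ev2 l (chart \<sigma> \<tau> x) = 0"
      if "l \<in> bivar 1" "ev2 l (chart \<sigma> \<tau> a) = 0" "ev2 l (chart \<sigma> \<tau> b) = 0" "x \<in> A" for l x
      using linear_vanishes_on_collinear[OF polyfun_chart[OF that(1)] A ab that(2-4)] .
    then show ?thesis by blast
  next
    case False
    then have "A = {} \<or> (\<exists>a. A = {a})" by blast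
    then show ?thesis by auto
  qed
  then obtain a b where ab: "\<forall>l\<in>bivar 1. ev2 l (chart \<sigma> \<tau> a) = 0 \<longrightarrow> ev2 l (chart \<sigma> \<tau> b) = 0 \<longrightarrow>
      (\<forall>x\<in>A. ev2 l (chart \<sigma> \<tau> x) = 0)"
    by blast
  let ?T = "{chart \<sigma> \<tau> a, chart \<sigma> \<tau> b}"
  have "card ?T \<le> 2" using card_length[of "[chart \<sigma> \<tau> a, chart \<sigma> \<tau> b]"] by simp
  then have "\<exists>l\<in>bivar 1. l \<noteq> 0 \<and> (\<forall>x\<in>?T. ev2 l x = 0)"
    using triangle_numerals(1) by (intro exists_vanishing) simp_all
  then show ?thesis using ab by blast
qed

lemma two_lines_conic:
  assumes "A \<subseteq> plane p u w" "B \<subseteq> plane p u w" "collinear_pts A" "collinear_pts B"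
  shows "on_plane_curve 2 (A \<union> B)"
proof -
  obtain k l where kl: "k \<in> bivar 1" "k \<noteq> 0" "\<forall>x\<in>A. ev2 k (chart \<sigma> \<tau> x) = 0"
    "l \<in> bivar 1" "l \<noteq> 0" "\<forall>x\<in>B. ev2 l (chart \<sigma> \<tau> x) = 0"
    using line_of_collinear[OF assms(3)] line_of_collinear[OF assms(4)] by blast
  have "k * l \<in> bivar 2" using bivar_mult[OF kl(1,4)] by (simp add: numeral_2_eq_2)
  then show ?thesis
    using kl assms(1,2) by (intro on_plane_curve_chart[of _ "k * l"]) auto
qed

lemma card_on_curve_chart:
  assumes "S \<subseteq> plane p u w"
  shows "card (on_curve q (chart \<sigma> \<tau> ` S)) = card {x \<in> S. ev2 q (chart \<sigma> \<tau> x) = 0}"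
proof -
  have "on_curve q (chart \<sigma> \<tau> ` S) = chart \<sigma> \<tau> ` {x \<in> S. ev2 q (chart \<sigma> \<tau> x) = 0}"
    by (auto simp: on_curve_def)
  moreover have "inj_on (chart \<sigma> \<tau>) {x \<in> S. ev2 q (chart \<sigma> \<tau> x) = 0}"
    using inj_on_chart[OF assms] by (rule inj_on_subset) blast
  ultimately show ?thesis by (simp add: card_image)
qed

end

lemma plane_chart_exists:
  fixes S :: "('r::finite \<Rightarrow> 'a::{field,finite}) set"
  assumes "coplanar S"
  shows "\<exists>p u w \<sigma> \<tau>. plane_chart p u w \<sigma> \<tau> \<and> S \<subseteq> plane p u w"
proof -
  obtain p u w where S: "lin_indep2 u w" "S \<subseteq> plane p u w"
    using assms unfolding coplanar_def by blast
  obtain \<sigma> \<tau> where "\<sigma> \<in> polyfun 1" "\<tau> \<in> polyfun 1"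
    "\<forall>x s t. in_plane_at p u w x s t \<longrightarrow> \<sigma> x = s \<and> \<tau> x = t"
    using plane_coordinates[OF S(1), of p] by blast
  then have "plane_chart p u w \<sigma> \<tau>" using S(1) by (intro plane_chart.intro) simp_all
  then show ?thesis using S(2) by blast
qed

section \<open>Hyperplane residuals and reduction to the plane\<close>

lemma residual_card:
  assumes "finite S" "T \<subseteq> S" "\<forall>x\<in>T. f x = 0"
  shows "card {x \<in> S. f x \<noteq> 0} + card T \<le> card S"
proof -
  have "card {x \<in> S. f x \<noteq> 0} + card T = card ({x \<in> S. f x \<noteq> 0} \<union> T)"
    using assms finite_subset[OF assms(2,1)] by (intro card_Un_disjoint[symmetric]) auto
  also have "\<dots> \<le> card S" using assms by (intro card_mono) auto
  finally show ?thesis .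
qed

lemma collinear_residual:
  assumes "pf.cayley_bacharach m S" "f \<in> polyfun 1" "1 \<le> m"
  defines "R \<equiv> {x \<in> S. f x \<noteq> 0}"
  shows "pf.cayley_bacharach (m - 1) R"
    and "R \<noteq> {} \<Longrightarrow> m + 1 \<le> card R"
    and "card R \<le> 2 * m - 1 \<Longrightarrow> collinear_pts R"
proof -
  show cb: "pf.cayley_bacharach (m - 1) R"
    unfolding R_def using assms by (intro pf.cayley_bacharach_residual)
  show "m + 1 \<le> card R" if "R \<noteq> {}"
    using pf.cayley_bacharach_card_ge[OF cb that] assms(3) by simp
  show "collinear_pts R" if "card R \<le> 2 * m - 1"
    using pf.cayley_bacharach_on_line[OF cb] that assms(3) by (intro on_line_imp_collinear) simp
qed

text \<open>A hyperplane through three points leaves at least \<open>m + 1\<close> points on a line.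
  That line and one of the three points span a coplanar set of at least \<open>m + 2\<close> points,
  and a hyperplane through it leaves at most \<open>m\<close>, too few for a nonempty
  residual.\<close>

lemma coplanar_of_small:
  fixes S :: "('r::finite \<Rightarrow> 'a::field) set"
  assumes r2: "2 \<le> card (UNIV :: 'r set)"
    and cb: "pf.cayley_bacharach m S" and card: "card S \<le> 2 * m + 2"
  shows "coplanar S"
proof (rule ccontr)
  assume nc: "\<not> coplanar S"
  have fin: "finite S" using cb by (rule pf.cayley_bacharach_finite)
  have c4: "4 \<le> card S" using coplanar_card_le_3[OF r2 fin] nc by fastforce
  then have m1: "1 \<le> m" using card by simp
  obtain T where T: "T \<subseteq> S" "card T = 3" "finite T"
    using obtain_subset_with_card_n[of 3 S] c4 by auto
  obtain f where f: "f \<in> polyfun 1" "\<forall>x\<in>T. f x = 0" "\<exists>z\<in>S. f z \<noteq> 0"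
    using separating_hyperplane[OF coplanar_card_le_3[OF r2 T(3)] nc] T(2) by auto
  let ?R = "{x \<in> S. f x \<noteq> 0}"
  note res = collinear_residual[OF cb f(1) m1]
  have "card ?R \<le> 2 * m - 1" using residual_card[OF fin T(1) f(2)] T(2) card by linarith
  then have col: "collinear_pts ?R" by (rule res(3))
  have R: "m + 1 \<le> card ?R" using f(3) by (intro res(2)) blast
  obtain t where t: "t \<in> T" using T(2) by (metis all_not_in_conv card.empty zero_neq_numeral)
  obtain g where g: "g \<in> polyfun 1" "\<forall>x\<in>insert t ?R. g x = 0" "\<exists>z\<in>S. g z \<noteq> 0"
    using separating_hyperplane[OF coplanar_insert_collinear[OF r2 col] nc] by blast
  have "card (insert t ?R) = card ?R + 1" using fin t f(2) by simp
  moreover have "insert t ?R \<subseteq> S" using t T(1) by auto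
  ultimately have "card {x \<in> S. g x \<noteq> 0} \<le> m"
    using residual_card[OF fin _ g(2)] R card by force
  moreover have "m + 1 \<le> card {x \<in> S. g x \<noteq> 0}"
    using g(3) by (intro collinear_residual(2)[OF cb g(1) m1]) blast
  ultimately show False by simp
qed

lemma space_conic:
  fixes S :: "('r::finite \<Rightarrow> 'a::{field,finite}) set"
  assumes r2: "2 \<le> card (UNIV :: 'r set)"
    and cb: "pf.cayley_bacharach m S" and ne: "S \<noteq> {}" and card: "card S \<le> 2 * m + 2"
  shows "(\<exists>T\<subseteq>S. m + 2 \<le> card T \<and> collinear_pts T) \<or> (card S = 2 * m + 2 \<and> on_plane_curve 2 S)"
proof -
  obtain p u w \<sigma> \<tau> where ch: "plane_chart p u w \<sigma> \<tau>" and S: "S \<subseteq> plane p u w"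
    using plane_chart_exists[OF coplanar_of_small[OF r2 cb card]] by blast
  interpret plane_chart p u w \<sigma> \<tau> by (rule ch)
  let ?S = "chart \<sigma> \<tau> ` S"
  have cS: "card ?S = card S" using inj_on_chart[OF S] by (rule card_image)
  have "(\<exists>l\<in>bivar 1. l \<noteq> 0 \<and> m + 2 \<le> card (on_curve l ?S)) \<or>
    (card ?S = 2 * m + 2 \<and> (\<exists>Q\<in>bivar 2. Q \<noteq> 0 \<and> (\<forall>x\<in>?S. ev2 Q x = 0)))"
    using planar_conic[OF planar_cb_chart[OF cb S]] ne card cS by simp
  then show ?thesis
  proof (elim disjE conjE bexE)
    fix l assume l: "l \<in> bivar 1" "l \<noteq> 0" "m + 2 \<le> card (on_curve l ?S)"
    let ?T = "{x \<in> S. ev2 l (chart \<sigma> \<tau> x) = 0}"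
    have "collinear_pts ?T" using S l by (intro collinear_chart[of _ l]) auto
    moreover have "m + 2 \<le> card ?T" using l(3) by (simp add: card_on_curve_chart[OF S])
    ultimately show ?thesis by (intro disjI1 exI[of _ ?T]) simp
  next
    fix Q assume "card ?S = 2 * m + 2" "Q \<in> bivar 2" "Q \<noteq> 0" "\<forall>x\<in>?S. ev2 Q x = 0"
    then show ?thesis using on_plane_curve_chart[OF S, of Q 2] cS by simp
  qed
qed

definition space_alternatives :: "nat \<Rightarrow> ('r \<Rightarrow> 'a::field) set \<Rightarrow> bool" where
  "space_alternatives m S \<longleftrightarrow>
     (\<exists>T\<subseteq>S. m + 2 \<le> card T \<and> collinear_pts T) \<or>
     (\<exists>T\<subseteq>S. 2 * m + 2 \<le> card T \<and> on_plane_curve 2 T) \<or>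
     (card S = 3 * m \<and> on_plane_curve 3 S)"

lemma coplanar_alternatives:
  fixes S :: "('r::finite \<Rightarrow> 'a::{field,finite}) set"
  assumes cp: "coplanar S"
    and cb: "pf.cayley_bacharach m S" and ne: "S \<noteq> {}" and card: "card S \<le> 3 * m"
  shows "space_alternatives m S"
proof -
  obtain p u w \<sigma> \<tau> where ch: "plane_chart p u w \<sigma> \<tau>" and S: "S \<subseteq> plane p u w"
    using plane_chart_exists[OF cp] by blast
  interpret plane_chart p u w \<sigma> \<tau> by (rule ch)
  let ?S = "chart \<sigma> \<tau> ` S"
  have cS: "card ?S = card S" using inj_on_chart[OF S] by (rule card_image)
  have "planar_alternatives m ?S"
    using planar_main[OF planar_cb_chart[OF cb S]] ne card cS by simp
  then show ?thesis
    unfolding planar_alternatives_def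
  proof (elim disjE conjE bexE)
    fix l assume l: "l \<in> bivar 1" "l \<noteq> 0" "m + 2 \<le> card (on_curve l ?S)"
    let ?T = "{x \<in> S. ev2 l (chart \<sigma> \<tau> x) = 0}"
    have "collinear_pts ?T" using S l by (intro collinear_chart[of _ l]) auto
    moreover have "m + 2 \<le> card ?T" using l(3) by (simp add: card_on_curve_chart[OF S])
    ultimately show ?thesis
      unfolding space_alternatives_def by (intro disjI1 exI[of _ ?T]) simp
  next
    fix Q assume Q: "Q \<in> bivar 2" "Q \<noteq> 0" "2 * m + 2 \<le> card (on_curve Q ?S)"
    let ?T = "{x \<in> S. ev2 Q (chart \<sigma> \<tau> x) = 0}"
    have "on_plane_curve 2 ?T" using S Q by (intro on_plane_curve_chart[of _ Q]) auto
    moreover have "2 * m + 2 \<le> card ?T" using Q(3) by (simp add: card_on_curve_chart[OF S])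
    ultimately show ?thesis
      unfolding space_alternatives_def by (intro disjI2 disjI1 exI[of _ ?T]) simp
  next
    fix Q assume "card ?S = 3 * m" "Q \<in> bivar 3" "Q \<noteq> 0" "\<forall>x\<in>?S. ev2 Q x = 0"
    then show ?thesis
      using on_plane_curve_chart[OF S, of Q 3] cS by (simp add: space_alternatives_def)
  qed
qed

text \<open>Any hyperplane through \<open>A\<close> and a further point of \<open>S\<close> leaves a
  collinear residual of at least \<open>m + 1\<close> points, if any. This gives a second line
  \<open>B\<close>. Coplanar lines form a conic; otherwise a hyperplane through \<open>A\<close> and
  one point \<open>y\<close> of \<open>B\<close> gives a third residual \<open>C\<close>, which
  turns out to be collinear with \<open>y\<close>.\<close>

lemma noncoplanar_line_case:
  fixes S :: "('r::finite \<Rightarrow> 'a::{field,finite}) set"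
  assumes r2: "2 \<le> card (UNIV :: 'r set)" and m: "2 \<le> m"
    and cb: "pf.cayley_bacharach m S" and card: "card S \<le> 3 * m" and nc: "\<not> coplanar S"
    and A: "A \<subseteq> S" "collinear_pts A" "m + 1 \<le> card A" and x: "x \<in> S" "x \<notin> A"
  shows "space_alternatives m S"
proof -
  have fin: "finite S" using cb by (rule pf.cayley_bacharach_finite)
  have finA: "finite A" using A(1) fin by (rule finite_subset)
  have m1: "1 \<le> m" using m by simp
  have residual: "collinear_pts {z \<in> S. f z \<noteq> 0} \<and> m + 1 \<le> card {z \<in> S. f z \<noteq> 0}"
    if f: "f \<in> polyfun 1" "\<forall>z\<in>insert y A. f z = 0" "\<exists>z\<in>S. f z \<noteq> 0" and y: "y \<in> S" "y \<notin> A" for f y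
  proof -
    have "card (insert y A) = card A + 1" using finA y(2) by simp
    then have "card {z \<in> S. f z \<noteq> 0} \<le> 2 * m - 1"
      using residual_card[OF fin _ f(2)] A(1,3) y(1) card m by force
    then have "collinear_pts {z \<in> S. f z \<noteq> 0}" by (rule collinear_residual(3)[OF cb f(1) m1])
    moreover have "m + 1 \<le> card {z \<in> S. f z \<noteq> 0}"
      using f(3) by (intro collinear_residual(2)[OF cb f(1) m1]) blast
    ultimately show ?thesis by blast
  qed
  obtain f where f: "f \<in> polyfun 1" "\<forall>z\<in>insert x A. f z = 0" "\<exists>z\<in>S. f z \<noteq> 0"
    using separating_hyperplane[OF coplanar_insert_collinear[OF r2 A(2)] nc] by blast
  define B where "B = {z \<in> S. f z \<noteq> 0}"
  have B: "B \<subseteq> S" "collinear_pts B" "m + 1 \<le> card B" and AB: "A \<inter> B = {}"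
    using residual[OF f x] f(2) by (auto simp: B_def)
  have finB: "finite B" using B(1) fin by (rule finite_subset)
  show ?thesis
  proof (cases "coplanar (A \<union> B)")
    case True
    then obtain p u w \<sigma> \<tau> where ch: "plane_chart p u w \<sigma> \<tau>" and S: "A \<union> B \<subseteq> plane p u w"
      using plane_chart_exists by blast
    then have "on_plane_curve 2 (A \<union> B)"
      using A(2) B(2) by (intro plane_chart.two_lines_conic[OF ch]) auto
    moreover have "2 * m + 2 \<le> card (A \<union> B)"
      using A(3) B(3) card_Un_disjoint[OF finA finB AB] by simp
    ultimately show ?thesis unfolding space_alternatives_def using A(1) B(1) by (metis Un_least)
  next
    case False
    obtain y where y: "y \<in> B" using B(3) by fastforce
    have y': "y \<in> S" "y \<notin> A" using y B(1) AB by auto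
    obtain g where g: "g \<in> polyfun 1" "\<forall>z\<in>insert y A. g z = 0" "\<exists>z\<in>A \<union> B. g z \<noteq> 0"
      using separating_hyperplane[OF coplanar_insert_collinear[OF r2 A(2)] False] by blast
    then obtain z where z: "z \<in> B" "g z \<noteq> 0" by auto
    define C where "C = {z \<in> S. g z \<noteq> 0}"
    have C: "collinear_pts C" "m + 1 \<le> card C"
      using residual[OF g(1,2) _ y'] z B(1) by (auto simp: C_def)
    \<comment> \<open>The hyperplane \<open>g = 0\<close> does not contain \<open>B\<close>, so it
      meets the line of \<open>B\<close> only at \<open>y\<close>.\<close>
    have BC: "b \<in> C" if "b \<in> B" "b \<noteq> y" for b
    proof (rule ccontr)
      assume "b \<notin> C"
      then have "g b = 0" using that B(1) by (auto simp: C_def)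
      then have "g z = 0"
        using linear_vanishes_on_collinear[OF g(1) B(2), of y b z] y that z(1) g(2) by auto
      then show False using z(2) by simp
    qed
    \<comment> \<open>Two common points identify the lines of \<open>B\<close> and \<open>C\<close>,
      so \<open>y\<close> joins \<open>C\<close> to give \<open>m + 2\<close> collinear
      points.\<close>
    have "2 \<le> card (B - {y})" using B(3) finB y m by simp
    then obtain b c where bc: "b \<in> B - {y}" "c \<in> B - {y}" "b \<noteq> c" using two_elements by blast
    have "pf.on_line (insert y C)"
      unfolding pf.on_line_def
    proof (intro exI ballI impI)
      fix h v assume h: "h \<in> polyfun 1" "h b = 0" "h c = 0" and v: "v \<in> insert y C"
      show "h v = 0"
      proof (cases "v = y")
        case True
        then show ?thesis
          using linear_vanishes_on_collinear[OF h(1) B(2), of b c y] bc h y by auto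
      next
        case False
        then show ?thesis
          using linear_vanishes_on_collinear[OF h(1) C(1), of b c v] bc h v BC by auto
      qed
    qed
    then have "collinear_pts (insert y C)" by (rule on_line_imp_collinear)
    moreover have "card (insert y C) = card C + 1"
      using fin g(2) by (simp add: C_def)
    moreover have "insert y C \<subseteq> S" using y'(1) by (auto simp: C_def)
    ultimately show ?thesis
      unfolding space_alternatives_def using C(2)
      by (intro disjI1 exI[of _ "insert y C"]) simp
  qed
qed

text \<open>For noncoplanar \<open>S\<close>, induction is applied to the residual of a hyperplane
  through three points. A line in the residual leads to \<open>noncoplanar_line_case\<close>; a
  plane conic or cubic there contains too many coplanar points.\<close>

lemma space_main:
  fixes S :: "('r::finite \<Rightarrow> 'a::{field,finite}) set"
  assumes r2: "2 \<le> card (UNIV :: 'r set)"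
    and "pf.cayley_bacharach m S" "S \<noteq> {}" "card S \<le> 3 * m"
  shows "space_alternatives m S"
  using assms(2-4)
proof (induction m arbitrary: S)
  case (Suc k)
  define m where "m = Suc k"
  note cb = Suc.prems(1)[folded m_def] and card = Suc.prems(3)[folded m_def]
  have fin: "finite S" using cb by (rule pf.cayley_bacharach_finite)
  have "space_alternatives m S"
  proof (cases "coplanar S")
    case True
    then show ?thesis using coplanar_alternatives cb Suc.prems(2) card by blast
  next
    case nc: False
    have m3: "3 \<le> m"
    proof (rule ccontr)
      assume "\<not> ?thesis"
      then have "card S \<le> 2 * m + 2" using card by linarith
      then show False using coplanar_of_small[OF r2 cb] nc by blast
    qed
    then have m1: "1 \<le> m" by simp
    have "\<not> card S \<le> 3" using coplanar_card_le_3[OF r2 fin] nc by blast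
    then obtain T where T: "T \<subseteq> S" "card T = 3" "finite T"
      using obtain_subset_with_card_n[of 3 S] by auto
    obtain f where f: "f \<in> polyfun 1" "\<forall>x\<in>T. f x = 0" "\<exists>z\<in>S. f z \<noteq> 0"
      using separating_hyperplane[OF coplanar_card_le_3[OF r2 T(3)] nc] T(2) by auto
    define R where "R = {x \<in> S. f x \<noteq> 0}"
    have cbR: "pf.cayley_bacharach k R"
      using collinear_residual(1)[OF cb f(1) m1] by (simp add: R_def m_def)
    have "card R \<le> 3 * k"
      using residual_card[OF fin T(1) f(2)] T(2) card by (simp add: R_def m_def)
    moreover have "R \<noteq> {}" using f(3) by (auto simp: R_def)
    ultimately have "space_alternatives k R" using Suc.IH cbR by blast
    \<comment> \<open>A hyperplane through a coplanar \<open>U\<close> leaves a nonempty residual,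
      hence at least \<open>m + 1\<close> points outside \<open>U\<close>. With \<open>2 * m\<close>
      or \<open>3 * (m - 1)\<close> points in \<open>U\<close> the total exceeds
      \<open>3 * m\<close>.\<close>
    have large: "m + 1 + card U \<le> card S" if U: "U \<subseteq> S" "coplanar U" for U
    proof -
      obtain g where g: "g \<in> polyfun 1" "\<forall>x\<in>U. g x = 0" "\<exists>z\<in>S. g z \<noteq> 0"
        using separating_hyperplane[OF U(2) nc] by blast
      have "m + 1 \<le> card {x \<in> S. g x \<noteq> 0}"
        using g(3) by (intro collinear_residual(2)[OF cb g(1) m1]) blast
      then show ?thesis using residual_card[OF fin U(1) g(2)] by simp
    qed
    have RS: "R \<subseteq> S" by (auto simp: R_def)
    from \<open>space_alternatives k R\<close> show ?thesis
      unfolding space_alternatives_def[of k R]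
    proof (elim disjE exE conjE)
      fix A assume A: "A \<subseteq> R" "k + 2 \<le> card A" "collinear_pts A"
      obtain t where t: "t \<in> T" using T(2) by (metis all_not_in_conv card.empty zero_neq_numeral)
      then have "t \<in> S" "t \<notin> A" using T(1) A(1) f(2) by (auto simp: R_def)
      then show ?thesis
        using A RS m3 by (intro noncoplanar_line_case[OF r2 _ cb card nc, of A t]) (auto simp: m_def)
    next
      fix U assume U: "U \<subseteq> R" "2 * k + 2 \<le> card U" "on_plane_curve 2 U"
      then have "m + 1 + card U \<le> card S"
        using large[of U] RS on_plane_curve_coplanar by blast
      then show ?thesis using U(2) card by (simp add: m_def)
    next
      assume "card R = 3 * k" "on_plane_curve 3 R"
      moreover from this have "m + 1 + card R \<le> card S"
        using large[of R] RS on_plane_curve_coplanar by blast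
      ultimately show ?thesis using card m3 by (simp add: m_def)
    qed
  qed
  then show ?case by (simp add: m_def)
qed (auto dest: pf.cayley_bacharach_finite)

section \<open>Codewords of the dual code and the final statement\<close>

lemma bpoly_eval_extend:
  assumes "k \<le> m"
  shows "bpoly_eval m (\<lambda>i j. if i + j \<le> k then a i j else 0) s t = bpoly_eval k a s t"
proof -
  have "bpoly_eval m (\<lambda>i j. if i + j \<le> k then a i j else 0) s t
      = (\<Sum>i\<le>m. \<Sum>j\<le>m. if i + j \<le> k then a i j * s ^ i * t ^ j else 0)"
    unfolding bpoly_eval_def using assms by (intro sum.cong refl) auto
  also have "\<dots> = (\<Sum>i\<le>k. \<Sum>j\<le>m. if i + j \<le> k then a i j * s ^ i * t ^ j else 0)"
    using assms by (intro sum.mono_neutral_right) (auto intro!: sum.neutral)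
  also have "\<dots> = bpoly_eval k a s t"
    unfolding bpoly_eval_def using assms
    by (intro sum.cong refl sum.mono_neutral_right) auto
  finally show ?thesis .
qed

text \<open>The nonzero coordinates serve as weights: each polynomial function agrees at the
  evaluation points with some member of \<open>L\<close>, to which the codeword is
  orthogonal.\<close>

lemma cayley_bacharach_of_codeword:
  assumes polys: "\<forall>a. \<exists>f\<in>L. \<forall>i<n. ev f (P i) = mpoly_eval m a (P i)"
    and inj: "inj_on P {..<n}"
    and c: "c \<in> dual_code n (eval_code L ev P n)"
  shows "pf.cayley_bacharach m (P ` {i. i < n \<and> c i \<noteq> 0})"
proof -
  let ?I = "{i. i < n \<and> c i \<noteq> 0}"
  have inj': "inj_on P ?I" using inj by (rule inj_on_subset) auto
  have "(\<Sum>x\<in>P ` ?I. c (inv_into ?I P x) * g x) = 0" if "g \<in> polyfun m" for g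
  proof -
    obtain a where a: "g = mpoly_eval m a" using \<open>g \<in> polyfun m\<close> by (auto simp: polyfun_def)
    obtain f where f: "f \<in> L" "\<forall>i<n. ev f (P i) = g (P i)" using polys a by blast
    define v where "v i = (if i < n then ev f (P i) else 0)" for i
    have "v \<in> eval_code L ev P n" using f(1) by (auto simp: eval_code_def v_def)
    then have "(\<Sum>i<n. c i * v i) = 0" using c by (simp add: dual_code_def)
    moreover have "(\<Sum>i<n. c i * v i) = (\<Sum>i\<in>?I. c i * g (P i))"
      by (rule sum.mono_neutral_cong_right) (auto simp: v_def f(2))
    ultimately show ?thesis by (simp add: sum.reindex[OF inj'] inv_into_f_f[OF inj'])
  qed
  then show ?thesis
    unfolding pf.cayley_bacharach_def
    by (intro conjI exI[of _ "\<lambda>x. c (inv_into ?I P x)"]) (auto simp: inv_into_f_f[OF inj'])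
qed

theorem theorem1:
  fixes L :: "'f set"
    and ev :: "'f \<Rightarrow> ('r::finite \<Rightarrow> 'a::{field,finite}) \<Rightarrow> 'a"
    and P :: "nat \<Rightarrow> ('r \<Rightarrow> 'a)"
    and n m d :: nat
    and c :: "nat \<Rightarrow> 'a"
  assumes r2: "card (UNIV :: 'r set) \<ge> 2"
    and LG_contains_polys: "\<forall>a. \<exists>f\<in>L. \<forall>i<n. ev f (P i) = mpoly_eval m a (P i)"
    and distinct_pts: "inj_on P {..<n}"
    and d_def: "d = min_distance n (dual_code n (eval_code L ev P n))"
    and c_code: "c \<in> dual_code n (eval_code L ev P n)"
    and c_nonzero: "c \<noteq> (\<lambda>_. 0)"
    and c_weight: "weight n c = d"
  defines "S \<equiv> P ` {i. i < n \<and> c i \<noteq> 0}"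
  shows
    "(d \<le> m + 2 \<longrightarrow> d = m + 2 \<and> collinear_pts S)
   \<and> (d \<le> 2 * m + 2 \<and> (\<forall>T\<subseteq>S. card T = m + 2 \<longrightarrow> \<not> collinear_pts T)
        \<longrightarrow> d = 2 * m + 2 \<and> on_plane_curve 2 S)
   \<and> (d \<le> 3 * m \<and> (\<forall>T\<subseteq>S. card T = m + 2 \<longrightarrow> \<not> collinear_pts T)
        \<and> (\<forall>T\<subseteq>S. card T = 2 * m + 2 \<longrightarrow> \<not> on_plane_curve 2 T)
        \<longrightarrow> d = 3 * m \<and>
          (\<exists>p u w a3 am. lin_indep2 u w \<and> bpoly_nonzero 3 a3 \<and> bpoly_nonzero m am \<and>
             (\<forall>x\<in>S. \<exists>s t. in_plane_at p u w x s t \<and> bpoly_eval 3 a3 s t = 0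
                                              \<and> bpoly_eval m am s t = 0)))"
proof -
  have cb: "pf.cayley_bacharach m S"
    unfolding S_def by (rule cayley_bacharach_of_codeword[OF LG_contains_polys distinct_pts c_code])
  have cS: "card S = d"
  proof -
    have "inj_on P {i. i < n \<and> c i \<noteq> 0}" using distinct_pts by (rule inj_on_subset) auto
    then show ?thesis unfolding S_def by (simp add: card_image weight_def flip: c_weight)
  qed
  have ne: "S \<noteq> {}"
  proof -
    obtain i where "c i \<noteq> 0" using c_nonzero by blast
    moreover have "\<forall>i\<ge>n. c i = 0" using c_code by (simp add: dual_code_def)
    ultimately have "i < n" "c i \<noteq> 0" by (auto simp: not_le[symmetric])
    then show ?thesis unfolding S_def by blast
  qed
  \<comment> \<open>The alternatives provide at least \<open>m + 2\<close> collinear points, the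
    hypotheses exclude exactly \<open>m + 2\<close>; a subset bridges the two, and likewise for
    conics.\<close>
  have line: "\<exists>U\<subseteq>S. card U = m + 2 \<and> collinear_pts U"
    if T: "T \<subseteq> S" "m + 2 \<le> card T" "collinear_pts T" for T
  proof -
    obtain U where "U \<subseteq> T" "card U = m + 2" using obtain_subset_with_card_n[OF T(2)] by blast
    moreover from this have "collinear_pts U" using T(3) unfolding collinear_pts_def by blast
    ultimately show ?thesis using T(1) by blast
  qed
  have conic: "\<exists>U\<subseteq>S. card U = 2 * m + 2 \<and> on_plane_curve 2 U"
    if T: "T \<subseteq> S" "2 * m + 2 \<le> card T" "on_plane_curve 2 T" for T
  proof -
    obtain U where U: "U \<subseteq> T" "card U = 2 * m + 2" using obtain_subset_with_card_n[OF T(2)] by blast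
    obtain p u w a where "lin_indep2 u w" "bpoly_nonzero 2 a"
      "\<forall>x\<in>T. \<exists>s t. in_plane_at p u w x s t \<and> bpoly_eval 2 a s t = 0"
      using T(3) unfolding on_plane_curve_def by blast
    then have "on_plane_curve 2 U" using U(1) unfolding on_plane_curve_def by blast
    then show ?thesis using T(1) U by blast
  qed
  have part1: "d = m + 2 \<and> collinear_pts S" if "d \<le> m + 2"
    using pf.cayley_bacharach_card_ge[OF cb ne] pf.cayley_bacharach_on_line'[OF cb] that cS
    by (auto intro: on_line_imp_collinear)
  have part2: "d = 2 * m + 2 \<and> on_plane_curve 2 S"
    if "d \<le> 2 * m + 2" "\<forall>T\<subseteq>S. card T = m + 2 \<longrightarrow> \<not> collinear_pts T"
    using space_conic[OF r2 cb ne] that line cS by blast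
  have part3: "d = 3 * m \<and>
      (\<exists>p u w a3 am. lin_indep2 u w \<and> bpoly_nonzero 3 a3 \<and> bpoly_nonzero m am \<and>
         (\<forall>x\<in>S. \<exists>s t. in_plane_at p u w x s t \<and> bpoly_eval 3 a3 s t = 0 \<and> bpoly_eval m am s t = 0))"
    if d: "d \<le> 3 * m" and nl: "\<forall>T\<subseteq>S. card T = m + 2 \<longrightarrow> \<not> collinear_pts T"
      and nc: "\<forall>T\<subseteq>S. card T = 2 * m + 2 \<longrightarrow> \<not> on_plane_curve 2 T"
  proof -
    \<comment> \<open>Otherwise the second part would make \<open>S\<close> itself an excluded set
      of \<open>2 * m + 2\<close> points on a conic. Hence
      \<open>2 * m + 3 \<le> 3 * m\<close>.\<close>
    have "\<not> d \<le> 2 * m + 2" using part2[OF _ nl] nc cS by blast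
    then have m3: "3 \<le> m" using d by linarith
    have "space_alternatives m S" using space_main[OF r2 cb ne] d cS by simp
    then have "card S = 3 * m \<and> on_plane_curve 3 S"
      unfolding space_alternatives_def
    proof (elim disjE exE conjE)
      fix T assume "T \<subseteq> S" "m + 2 \<le> card T" "collinear_pts T"
      from line[OF this] show ?thesis using nl by blast
    next
      fix T assume "T \<subseteq> S" "2 * m + 2 \<le> card T" "on_plane_curve 2 T"
      from conic[OF this] show ?thesis using nc by blast
    qed simp
    then obtain p u w a where pc: "lin_indep2 u w" "bpoly_nonzero 3 a"
      "\<forall>x\<in>S. \<exists>s t. in_plane_at p u w x s t \<and> bpoly_eval 3 a s t = 0" and dm: "d = 3 * m"
      unfolding on_plane_curve_def using cS by blast
    \<comment> \<open>The cubic padded with zero coefficients is the curve of degree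
      \<open>m\<close>.\<close>
    define b where "b = (\<lambda>i j. if i + j \<le> 3 then a i j else 0)"
    have "bpoly_nonzero m b"
      using pc(2) m3 unfolding bpoly_nonzero_def b_def by (metis order_trans)
    moreover have "bpoly_eval m b s t = bpoly_eval 3 a s t" for s t
      unfolding b_def using m3 by (rule bpoly_eval_extend)
    ultimately show ?thesis using pc dm by metis
  qed
  show ?thesis using part1 part2 part3 by blast
qed

end
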